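(* For every integer $a\ge2$, $$\partial\mathcal{G}_a=\bigcup_{u\in B}\mathcal{G}_a\cap(\mathcal{G}_a+u),\qquad\text{where } B=\{\pm1,\ \pm\alpha,\ \pm(\alpha-1)\}.$$
   Context: Let $a\ge2$ be an integer and write $x^3-ax^2+x-1=(x-\beta)(x-\alpha)(x-\gamma)$ with $\beta>1$ real and $\alpha,\gamma\in\mathbb{C}\setminus\mathbb{R}$ complex conjugates, $|\alpha|<1$. $<_{lex}$ is the lexicographic order on finite words of equal length over $\{0,\dots,a-1\}$. $\mathcal{G}_a$ is the set of all $\sum_{i=2}^\infty a_i\alpha^i$ such that for all $N\ge2$ the word $(a_i)_{2\le i\le N}$ is a greedy $G$-expansion, i.e. $a_i\in\{0,\dots,a-1\}$, $a_ia_{i-1}a_{i-2}a_{i-3}<_{lex}(a-1)(a-1)01$ for all $i\ge5$, and $a_3a_2<_{lex}(a-1)(a-1)$, $a_4a_3a_2<_{lex}(a-1)(a-1)0$. $\partial$ denotes topological boundary in $\mathbb{C}$. *)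

theory Defs
  imports "HOL-Analysis.Analysis" "HOL-Computational_Algebra.Polynomial"
begin

text \<open>
  The word \<open>(w i)\<close> with \<open>2 \<le> i \<le> N\<close> is read from the highest index downwards, and a
  constraint applies only once all the digits it mentions are present.  The relation
  \<open>lex less_than\<close> relates lists of equal length only.
\<close>

definition greedy_G_expansion :: "nat \<Rightarrow> nat \<Rightarrow> (nat \<Rightarrow> nat) \<Rightarrow> bool" where
  "greedy_G_expansion a N w \<longleftrightarrow>
     (\<forall>i\<in>{2..N}. w i \<in> {0..a - 1}) \<and>
     (\<forall>i\<in>{5..N}. ([w i, w (i - 1), w (i - 2), w (i - 3)], [a - 1, a - 1, 0, 1]) \<in> lex less_than) \<and>
     (3 \<le> N \<longrightarrow> ([w 3, w 2], [a - 1, a - 1]) \<in> lex less_than) \<and>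
     (4 \<le> N \<longrightarrow> ([w 4, w 3, w 2], [a - 1, a - 1, 0]) \<in> lex less_than)"

text \<open>The series are shifted so that summation over \<open>nat\<close> starts at the exponent 2.\<close>

definition G_set :: "nat \<Rightarrow> complex \<Rightarrow> complex set" where
  "G_set a \<alpha> = {z. \<exists>w. (\<forall>N\<ge>2. greedy_G_expansion a N w) \<and>
     (\<lambda>i. of_nat (w (i + 2)) * \<alpha> ^ (i + 2)) sums z}"

end

theory Submission
  imports Defs
begin

text \<open>
  Write \<open>X\<close> for the set of values of finite greedy words and \<open>\<Lambda>\<close> for the lattice
  \<open>\<int> + \<int>\<alpha>\<close>.  The ring \<open>\<int>[\<alpha>]\<close> is identified with \<open>\<int>\<^sup>3\<close> through the basis
  \<open>1, \<alpha>, \<alpha>\<^sup>2\<close>; the third coordinate is a linear form with kernel \<open>\<Lambda>\<close>.  For every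
  \<open>n\<close> there is exactly one point \<open>x\<^sub>n\<close> of \<open>X\<close> whose third coordinate is \<open>n\<close>, and
  \<open>x\<^sub>n\<^sub>+\<^sub>1 - x\<^sub>n - \<alpha>\<^sup>2\<close> is always one of \<open>0\<close>, \<open>1 - \<alpha>\<close>, \<open>1\<close>.  The set
  \<open>B\<close> of the theorem consists of the nonzero differences of these three vectors, and it
  enters the proof through the following fact (lemma \<open>orbit_add_alpha_pow\<close>): for all
  \<open>n\<close> and all \<open>j \<ge> 2\<close>,
  \<open>x\<^sub>n + \<alpha>\<^sup>j \<in> X + (B \<union> {0})\<close>.  To see it, note that the three vectors
  occur in the order given by the fixed point of a substitution, and that
  multiplication by \<open>\<alpha>\<close> sends \<open>x\<^sub>m\<close> to the first point of the \<open>m\<close>-th block of this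
  substitution.  Passing from \<open>j\<close> to \<open>j + 1\<close> thus becomes a finite computation with the
  error term in \<open>B \<union> {0}\<close> and two letters, which does not depend on \<open>a\<close>.

  The boundary lies in the union.  Suppose that \<open>z \<in> G\<close> belongs to no
  \<open>G + u\<close> with \<open>u \<in> B\<close>, and take a disc around \<open>z\<close> that avoids these closed sets.
  As long as one stays in the disc, the error term above must vanish, so the part of
  \<open>G\<close> in the disc is stable under the small translations \<open>\<plusminus>\<alpha>\<^sup>j\<close>.  Since \<open>\<alpha>\<close> is not
  real, two consecutive powers span the plane, and a point of the disc near \<open>z\<close> that is
  missing from \<open>G\<close> could be approached from its nearest point in \<open>G\<close>, which is absurd
  (lemma \<open>ball_subset_G_set\<close>).  Hence \<open>z\<close> is interior.

  The union lies in the boundary.  An interior point of \<open>G\<close> that lies in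
  \<open>G + u\<close> would produce some \<open>x\<^sub>n\<close> in \<open>G - u\<close>, because \<open>X\<close> is dense in \<open>G\<close>.  Lemma
  \<open>orbit_not_in_translate\<close> excludes this for \<open>u \<in> \<Lambda>\<close> different from \<open>0\<close>.  It rests on
  the finiteness property of \<open>\<beta>\<close> (lemma \<open>reaches_orbit_if_positive\<close>): if \<open>s \<in> \<int>[\<alpha>]\<close>
  has positive image under \<open>\<alpha> \<mapsto> \<beta>\<close>, then \<open>\<alpha>\<^sup>k s \<in> X\<close> for some \<open>k\<close>.  This property
  also comes from the fact above: every error term in \<open>B\<close> disappears after a few
  multiplications by \<open>\<alpha>\<close>, so the elements that eventually reach \<open>X\<close> are stable under adding
  powers of \<open>\<alpha>\<close>, and every positive element is, up to a power of \<open>\<alpha>\<close>, a sum of powers.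
\<close>

section \<open>The increments and their substitution\<close>

datatype letter = A | B | C | D

text \<open>The triple \<open>(p, q, r)\<close> stands for \<open>p + q\<alpha> + r\<alpha>\<^sup>2\<close>.  The letters name the four situations in which
  the successor of a point of \<open>X\<close> is formed; the increment is \<open>\<alpha>\<^sup>2\<close> plus this vector.\<close>

fun shift_vec :: "letter \<Rightarrow> int \<times> int \<times> int" where
  "shift_vec A = (0, 0, 0)"
| "shift_vec B = (1, -1, 0)"
| "shift_vec C = (1, 0, 0)"
| "shift_vec D = (1, 0, 0)"

locale cubic_base =
  fixes a :: nat
  assumes a_ge_2: "a \<ge> 2"
begin

text \<open>The substitution is \<open>A \<mapsto> A\<^sup>a\<^sup>-\<^sup>1 B\<close>, \<open>B \<mapsto> A\<^sup>a\<^sup>-\<^sup>2 C\<close>, \<open>C \<mapsto> A\<^sup>a\<^sup>-\<^sup>1 D\<close>,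
  \<open>D \<mapsto> A\<^sup>a\<^sup>-\<^sup>2 C A\<close>.  The letters \<open>C\<close> and \<open>D\<close> carry the same increment but have to be
  told apart: in digits, \<open>A\<close> and \<open>C\<close> end words after which all digits are allowed, whereas \<open>B\<close>
  and \<open>D\<close> end words with last digit \<open>a - 1\<close>.\<close>

definition block_len :: "letter \<Rightarrow> nat" where
  "block_len l = (if l = B then a - 1 else a)"

fun block :: "letter \<Rightarrow> nat \<Rightarrow> letter" where
  "block A c = (if c < a - 1 then A else B)"
| "block B c = (if c < a - 2 then A else C)"
| "block C c = (if c < a - 1 then A else D)"
| "block D c = (if c = a - 2 then C else A)"

definition subst_word :: "letter list \<Rightarrow> letter list" where
  "subst_word ls = concat (map (\<lambda>l. map (block l) [0..<block_len l]) ls)"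

definition iter :: "nat \<Rightarrow> letter list" where
  "iter k = (subst_word ^^ k) [A]"

definition letter_at :: "nat \<Rightarrow> letter" where
  "letter_at n = iter n ! n"

definition block_start :: "nat \<Rightarrow> nat" where
  "block_start n = (\<Sum>i<n. block_len (letter_at i))"

lemma block_len_pos: "block_len l > 0"
  using a_ge_2 by (simp add: block_len_def)

lemma subst_word_append: "subst_word (xs @ ys) = subst_word xs @ subst_word ys"
  by (simp add: subst_word_def)

lemma subst_word_nonempty: "xs \<noteq> [] \<Longrightarrow> subst_word xs \<noteq> []"
  using block_len_pos by (cases xs) (auto simp: subst_word_def)

lemma iter_Suc: "iter (Suc k) = subst_word (iter k)"
  by (simp add: iter_def)

text \<open>The image of \<open>A\<close> begins with \<open>A\<close>, so each iterate of the substitution is a prefix of the next;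
  their limit is the fixed point \<open>letter_at\<close>.\<close>

lemma iter_extends: "\<exists>r. r \<noteq> [] \<and> iter (Suc k) = iter k @ r"
proof (induction k)
  case 0
  have "[0..<a] = 0 # [1..<a]" using a_ge_2 by (simp add: upt_rec)
  then have "iter (Suc 0) = [A] @ map (block A) [1..<a]"
    using a_ge_2 by (simp add: iter_def subst_word_def block_len_def)
  moreover have "map (block A) [1..<a] \<noteq> []" using a_ge_2 by simp
  ultimately show ?case by (auto simp: iter_def)
next
  case (Suc k)
  then obtain r where "r \<noteq> []" "iter (Suc k) = iter k @ r" by blast
  then show ?case
    by (metis iter_Suc subst_word_append subst_word_nonempty)
qed

lemma iter_prefix: "k \<le> k' \<Longrightarrow> \<exists>r. iter k' = iter k @ r"
proof (induction k' rule: dec_induct)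
  case (step n)
  then show ?case using iter_extends[of n] by (metis append.assoc)
qed simp

lemma length_iter: "length (iter k) > k"
proof (induction k)
  case (Suc k)
  then show ?case using iter_extends[of k]
    by (metis Suc_lessI length_append length_greater_0_conv less_add_same_cancel1 less_trans not_less_eq)
qed (simp add: iter_def)

lemma nth_iter: assumes "i < length (iter k)" shows "iter k ! i = letter_at i"
proof -
  have "\<exists>r. iter k = iter i @ r \<or> iter i = iter k @ r"
    using iter_prefix[of k i] iter_prefix[of i k] by (metis nle_le)
  then show ?thesis using assms length_iter[of i]
    by (auto simp: letter_at_def nth_append)
qed

lemma block_start_0 [simp]: "block_start 0 = 0"
  by (simp add: block_start_def)

lemma block_start_Suc: "block_start (Suc n) = block_start n + block_len (letter_at n)"
  by (simp add: block_start_def)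

lemma nth_subst_word:
  assumes "m < length xs" "c < block_len (xs ! m)"
  shows "(\<Sum>i<m. block_len (xs ! i)) + c < length (subst_word xs)
    \<and> subst_word xs ! ((\<Sum>i<m. block_len (xs ! i)) + c) = block (xs ! m) c"
  using assms
proof (induction xs arbitrary: m)
  case (Cons y ys)
  show ?case
  proof (cases m)
    case 0
    with Cons.prems show ?thesis by (auto simp: subst_word_def nth_append)
  next
    case (Suc m')
    have "(\<Sum>i<m. block_len ((y # ys) ! i)) = block_len y + (\<Sum>i<m'. block_len (ys ! i))"
      by (simp only: Suc sum.lessThan_Suc_shift) simp
    with Cons.IH[of m'] Cons.prems Suc show ?thesis
      by (auto simp: subst_word_def nth_append)
  qed
qed simp

text \<open>Self-similarity of the fixed point: it is the concatenation of the images of its own letters.\<close>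

lemma letter_at_block:
  assumes "c < block_len (letter_at m)"
  shows "letter_at (block_start m + c) = block (letter_at m) c"
proof -
  have m: "m < length (iter m)" by (rule length_iter)
  have eq: "(\<Sum>i<m. block_len (iter m ! i)) = block_start m"
    unfolding block_start_def by (rule sum.cong) (use m in \<open>auto simp: nth_iter\<close>)
  have "c < block_len (iter m ! m)" using assms by (simp add: letter_at_def)
  from nth_subst_word[OF m this] show ?thesis
    unfolding eq by (metis iter_Suc letter_at_def nth_iter)
qed

lemma letter_at_0: "letter_at 0 = A"
  by (simp add: letter_at_def iter_def)

lemma block_decomposition:
  obtains m c where "n = block_start m + c" "c < block_len (letter_at m)"
proof -
  have "\<exists>m c. n = block_start m + c \<and> c < block_len (letter_at m)"
  proof (induction n)
    case 0
    then show ?case using block_len_pos by (metis add_0 block_start_0)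
  next
    case (Suc n)
    then obtain m c where mc: "n = block_start m + c" "c < block_len (letter_at m)" by blast
    show ?case
    proof (cases "Suc c < block_len (letter_at m)")
      case True with mc show ?thesis by (metis add_Suc_right)
    next
      case False
      with mc have "Suc n = block_start (Suc m) + 0" by (simp add: block_start_Suc)
      then show ?thesis using block_len_pos by blast
    qed
  qed
  with that show ?thesis by blast
qed

lemma block_start_gt: "m > 0 \<Longrightarrow> m < block_start m"
proof (induction m)
  case (Suc m)
  show ?case
  proof (cases m)
    case 0 then show ?thesis using a_ge_2 by (simp add: block_start_Suc letter_at_0 block_len_def)
  next
    case (Suc k)
    with Suc.IH show ?thesis using block_len_pos[of "letter_at m"] by (simp add: block_start_Suc)
  qed
qed simp

lemma block_start_ge: "m \<le> block_start m"
  using block_start_gt[of m] by (cases m) auto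

lemma letter_before_block:
  assumes "m > 0"
  shows "letter_at (block_start m - 1) =
    block (letter_at (m - 1)) (block_len (letter_at (m - 1)) - 1)"
  using assms letter_at_block[of "block_len (letter_at (m - 1)) - 1" "m - 1"]
    block_len_pos[of "letter_at (m - 1)"] block_start_Suc[of "m - 1"] by simp

lemma letter_at_block_start: "letter_at (block_start m) = block (letter_at m) 0"
  using letter_at_block[of 0 m] block_len_pos by simp

lemma letter_at_block_start_in: "letter_at (block_start m) \<in> {A, C}"
  using a_ge_2 by (cases "letter_at m") (auto simp: letter_at_block_start)

text \<open>Which letters can be adjacent matters whenever a carry leaves the block in which it starts.\<close>

lemma before_B:
  assumes "letter_at n = B" shows "n > 0 \<and> letter_at (n - 1) = A"
proof -
  obtain m c where mc: "n = block_start m + c" "c < block_len (letter_at m)"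
    by (rule block_decomposition)
  with assms have "block (letter_at m) c = B" by (simp add: letter_at_block)
  then have "letter_at m = A" "c \<ge> a - 1" by (cases "letter_at m"; simp split: if_splits)+
  with mc a_ge_2 show ?thesis
    using letter_at_block[of "c - 1" m] by (auto simp: block_len_def)
qed

lemma block_end_next:
  assumes "n = block_start m + c" "c < block_len (letter_at m)"
  shows "letter_at (Suc n) = (if Suc c < block_len (letter_at m) then block (letter_at m) (Suc c)
     else letter_at (block_start (Suc m)))"
  using assms letter_at_block[of "Suc c" m] 
  by (auto simp: block_start_Suc) (metis Suc_lessI add_Suc_right)

lemma after_B: "letter_at n = B \<Longrightarrow> letter_at (Suc n) \<in> {A, C}"
proof -
  assume n: "letter_at n = B"
  obtain m c where mc: "n = block_start m + c" "c < block_len (letter_at m)"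
    by (rule block_decomposition)
  with n have "block (letter_at m) c = B" by (simp add: letter_at_block)
  then have "letter_at m = A" "c \<ge> a - 1" by (cases "letter_at m"; simp split: if_splits)+
  with mc have "letter_at (Suc n) = letter_at (block_start (Suc m))"
    using block_end_next[OF mc] by (auto simp: block_len_def)
  then show ?thesis using letter_at_block_start_in by simp
qed

lemma after_C: "letter_at n = C \<Longrightarrow> letter_at (Suc n) = A"
proof -
  assume n: "letter_at n = C"
  obtain m c where mc: "n = block_start m + c" "c < block_len (letter_at m)"
    by (rule block_decomposition)
  with n have "block (letter_at m) c = C" by (simp add: letter_at_block)
  then have "letter_at m = B \<and> c \<ge> a - 2 \<or> letter_at m = D \<and> c = a - 2"
    by (cases "letter_at m"; simp split: if_splits)
  then show ?thesis
  proof
    assume h: "letter_at m = B \<and> c \<ge> a - 2"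
    with mc have "letter_at (Suc n) = letter_at (block_start (Suc m))"
      using block_end_next[OF mc] a_ge_2 by (auto simp: block_len_def)
    also have "\<dots> = A" using after_B[of m] h a_ge_2 by (auto simp: letter_at_block_start)
    finally show ?thesis .
  next
    assume h: "letter_at m = D \<and> c = a - 2"
    with mc show ?thesis
      using block_end_next[OF mc] a_ge_2 by (auto simp: block_len_def)
  qed
qed

lemma after_D: "letter_at n = D \<Longrightarrow> letter_at (Suc n) = A"
proof -
  assume n: "letter_at n = D"
  obtain m c where mc: "n = block_start m + c" "c < block_len (letter_at m)"
    by (rule block_decomposition)
  with n have "block (letter_at m) c = D" by (simp add: letter_at_block)
  then have h: "letter_at m = C \<and> c \<ge> a - 1"
    by (cases "letter_at m"; simp split: if_splits)
  with mc have "letter_at (Suc n) = letter_at (block_start (Suc m))"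
    using block_end_next[OF mc] a_ge_2 by (auto simp: block_len_def)
  also have "\<dots> = A" using after_C[of m] h a_ge_2 by (auto simp: letter_at_block_start)
  finally show ?thesis .
qed

text \<open>Powers above the second are reduced by \<open>\<alpha>\<^sup>3 = a\<alpha>\<^sup>2 - \<alpha> + 1\<close>.\<close>

fun times_alpha :: "int \<times> int \<times> int \<Rightarrow> int \<times> int \<times> int" where
  "times_alpha (p, q, r) = (r, p - r, q + int a * r)"

definition alpha_pow :: "nat \<Rightarrow> int \<times> int \<times> int" where
  "alpha_pow j = (times_alpha ^^ j) (1, 0, 0)"

primrec orbit :: "nat \<Rightarrow> int \<times> int \<times> int" where
  "orbit 0 = (0, 0, 0)"
| "orbit (Suc n) = orbit n + ((0, 0, 1) + shift_vec (letter_at n))"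

text \<open>The sum of \<open>shift_vec\<close> over the first \<open>c\<close> letters of the block of a given letter.\<close>

fun block_shift :: "letter \<Rightarrow> nat \<Rightarrow> int \<times> int \<times> int" where
  "block_shift A c = (if c < a then (0, 0, 0) else (1, -1, 0))"
| "block_shift B c = (if c < a - 1 then (0, 0, 0) else (1, 0, 0))"
| "block_shift C c = (if c < a then (0, 0, 0) else (1, 0, 0))"
| "block_shift D c = (if c < a - 1 then (0, 0, 0) else (1, 0, 0))"

lemma times_alpha_add: "times_alpha (u + v) = times_alpha u + times_alpha v"
  by (cases u; cases v) (simp add: algebra_simps)

lemma times_alpha_diff: "times_alpha (u - v) = times_alpha u - times_alpha v"
  by (cases u; cases v) (simp add: algebra_simps)

lemma orbit_in_block:
  assumes "orbit (block_start m) = times_alpha (orbit m)" "c \<le> block_len (letter_at m)"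
  shows "orbit (block_start m + c) = times_alpha (orbit m) + (0, 0, int c) + block_shift (letter_at m) c"
  using assms(2)
proof (induction c)
  case 0
  then show ?case using assms(1) a_ge_2
    by (cases "letter_at m"; cases "times_alpha (orbit m)") auto
next
  case (Suc c)
  then have "letter_at (block_start m + c) = block (letter_at m) c"
    by (simp add: letter_at_block)
  with Suc show ?case using a_ge_2
    by (cases "letter_at m"; cases "times_alpha (orbit m)") (auto simp: block_len_def)
qed

text \<open>The increments over the block of a letter add up to \<open>\<alpha>\<close> times the increment of the letter; the
  substitution is chosen for this.\<close>

lemma orbit_block_start: "orbit (block_start m) = times_alpha (orbit m)"
proof (induction m)
  case (Suc m)
  from orbit_in_block[OF Suc order_refl] show ?case using a_ge_2
    by (cases "letter_at m"; cases "orbit m")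
      (auto simp: block_start_Suc block_len_def algebra_simps)
qed simp

lemma orbit_block:
  "c \<le> block_len (letter_at m) \<Longrightarrow>
   orbit (block_start m + c) = times_alpha (orbit m) + (0, 0, int c) + block_shift (letter_at m) c"
  using orbit_in_block orbit_block_start by blast

end

section \<open>Adding a power of alpha\<close>

datatype pos = Low | PreLast | Last | End

text \<open>Only four kinds of positions in a block matter: before \<open>a - 2\<close>, equal to \<open>a - 2\<close>, equal to
  \<open>a - 1\<close>, and \<open>a\<close>, the end of a long block.  With them the computations below no longer mention \<open>a\<close>.\<close>

fun pos_letter :: "letter \<Rightarrow> pos \<Rightarrow> letter" where
  "pos_letter A p = (if p = Last then B else A)"
| "pos_letter B p = (if p = PreLast then C else A)"
| "pos_letter C p = (if p = Last then D else A)"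
| "pos_letter D p = (if p = PreLast then C else A)"

fun pos_shift :: "letter \<Rightarrow> pos \<Rightarrow> int \<times> int \<times> int" where
  "pos_shift A p = (if p = End then (1, -1, 0) else (0, 0, 0))"
| "pos_shift B p = (if p = Last then (1, 0, 0) else (0, 0, 0))"
| "pos_shift C p = (if p = End then (1, 0, 0) else (0, 0, 0))"
| "pos_shift D p = (if p = Last \<or> p = End then (1, 0, 0) else (0, 0, 0))"

fun end_pos :: "letter \<Rightarrow> pos" where
  "end_pos l = (if l = B then Last else End)"

fun last_letter :: "letter \<Rightarrow> letter" where
  "last_letter A = B" | "last_letter B = C" | "last_letter C = D" | "last_letter D = A"

fun inner_pos :: "letter \<Rightarrow> pos \<Rightarrow> bool" where
  "inner_pos l p = (p = Low \<or> p = PreLast \<or> p = Last \<and> l \<noteq> B)"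

fun next_pos :: "pos \<Rightarrow> pos \<Rightarrow> bool" where
  "next_pos Low p = (p = Low \<or> p = PreLast)"
| "next_pos PreLast p = (p = Last)"
| "next_pos Last p = (p = End)"
| "next_pos End p = False"

text \<open>An entry \<open>(x, y, l, l')\<close> describes a pair of indices with letters \<open>l\<close> and \<open>l'\<close> for which the first
  point, translated by a power of \<open>\<alpha>\<close>, differs from the second by the error term \<open>x + y\<alpha>\<close>.  The list is
  closed under passing to blocks, which is verified by enumeration; without the
  letters the error terms would not stay in \<open>B \<union> {0}\<close>.\<close>

definition neighbour_states :: "(int \<times> int \<times> letter \<times> letter) list" where
  "neighbour_states =
    [(0, 0, A, A), (0, 0, A, B), (0, 0, A, C), (0, 0, A, D),
     (0, 0, B, A), (0, 0, B, B), (0, 0, B, D),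
     (0, 0, C, A), (0, 0, C, C), (0, 0, C, D),
     (0, 0, D, A), (0, 0, D, B), (0, 0, D, C), (0, 0, D, D),
     (1, 0, A, B), (1, 0, A, C), (1, 0, A, D),
     (-1, 0, B, A), (-1, 0, C, A), (-1, 0, D, A),
     (0, 1, A, A), (0, 1, A, C), (0, 1, B, C), (0, 1, B, D), (0, 1, D, C),
     (0, -1, A, A), (0, -1, C, A), (0, -1, C, B), (0, -1, D, B), (0, -1, C, D),
     (-1, 1, B, A), (-1, 1, B, C),
     (1, -1, A, B), (1, -1, C, B)]"

text \<open>Multiplication by \<open>\<alpha>\<close> turns the error \<open>x + y\<alpha>\<close> into \<open>x\<alpha> + y\<alpha>\<^sup>2\<close>.  The part \<open>y\<alpha>\<^sup>2\<close> is absorbed by moving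
  \<open>y\<close> positions further from the second point, and the shifts accumulated inside the two blocks are
  added.\<close>

fun next_state :: "int \<times> int \<times> letter \<times> letter \<Rightarrow> pos \<Rightarrow> pos \<Rightarrow> letter \<Rightarrow> bool" where
  "next_state (x, y, l, l') p p' k = (case (pos_shift l p, pos_shift l' p') of ((u, v, _), (u', v', _)) \<Rightarrow>
     (u - u', x + v - v', pos_letter l p, k) \<in> set neighbour_states)"

text \<open>The three lemmas treat the cases that the moved position stays in its block, runs over its end,
  or falls before its beginning.\<close>

lemma neighbour_states_within:
  "\<forall>(x, y, l, l')\<in>set neighbour_states. \<forall>p\<in>{Low, PreLast, Last}. \<forall>p'\<in>{Low, PreLast, Last}.
     inner_pos l p \<longrightarrow> inner_pos l' p' \<longrightarrow>
     (if y = 0 then p' = p else if y = 1 then next_pos p p' else next_pos p' p) \<longrightarrow>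
     next_state (x, y, l, l') p p' (pos_letter l' p')"
  by code_simp

lemma neighbour_states_above:
  "\<forall>(x, y, l, l')\<in>set neighbour_states. \<forall>p\<in>{Low, PreLast, Last}. \<forall>k\<in>{A, C}.
     inner_pos l p \<longrightarrow> (k = A \<or> l' = A) \<longrightarrow>
     (if y = 0 then p = end_pos l' else if y = 1 then next_pos p (end_pos l') else False) \<longrightarrow>
     next_state (x, y, l, l') p (end_pos l') k"
  by code_simp

lemma neighbour_states_below:
  "\<forall>(x, y, l, l')\<in>set neighbour_states. \<forall>p\<in>{Low, PreLast}. \<forall>k\<in>{A, B, C, D}.
     y = -1 \<longrightarrow> (l' = B \<longrightarrow> k = A) \<longrightarrow>
     (case shift_vec (last_letter k) of (u, v, _) \<Rightarrow>
       (u, x + v, pos_letter l p, last_letter k) \<in> set neighbour_states)"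
  by code_simp

lemma next_state_within:
  assumes "(x, y, l, l') \<in> set neighbour_states" "inner_pos l p" "inner_pos l' p'"
    and "if y = 0 then p' = p else if y = 1 then next_pos p p' else next_pos p' p"
  shows "next_state (x, y, l, l') p p' (pos_letter l' p')"
proof -
  have "p \<in> {Low, PreLast, Last}" "p' \<in> {Low, PreLast, Last}" using assms(2,3) by auto
  from bspec[OF bspec[OF bspec[OF neighbour_states_within assms(1), unfolded case_prod_conv]
      this(1)] this(2)] assms show ?thesis by blast
qed

lemma next_state_above:
  assumes "(x, y, l, l') \<in> set neighbour_states" "inner_pos l p" "k \<in> {A, C}" "k = A \<or> l' = A"
    and "if y = 0 then p = end_pos l' else if y = 1 then next_pos p (end_pos l') else False"
  shows "next_state (x, y, l, l') p (end_pos l') k"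
proof -
  have "p \<in> {Low, PreLast, Last}" using assms(2) by auto
  from bspec[OF bspec[OF bspec[OF neighbour_states_above assms(1), unfolded case_prod_conv]
      this] assms(3)] assms show ?thesis by blast
qed

lemma next_state_below:
  assumes "(x, -1, l, l') \<in> set neighbour_states" "p \<in> {Low, PreLast}" "l' = B \<longrightarrow> k = A"
    and "shift_vec (last_letter k) = (u, v, 0)"
  shows "(u, x + v, pos_letter l p, last_letter k) \<in> set neighbour_states"
proof -
  have "k \<in> {A, B, C, D}" by (cases k) auto
  from bspec[OF bspec[OF bspec[OF neighbour_states_below assms(1), unfolded case_prod_conv]
      assms(2)] this] assms(3,4) show ?thesis by (simp del: pos_letter.simps last_letter.simps)
qed

lemma neighbour_states_second:
  "\<forall>(x, y, l, l')\<in>set neighbour_states. y \<in> {-1, 0, 1} \<and> (y = 1 \<longrightarrow> l' \<noteq> B)"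
  by code_simp

lemma neighbour_states_start:
  "\<forall>l\<in>{A, B, C, D}. \<forall>l'\<in>{A, B, C, D}. (l = B \<longrightarrow> l' \<in> {A, C}) \<longrightarrow> (l \<in> {C, D} \<longrightarrow> l' = A) \<longrightarrow>
     (case shift_vec l of (u, v, _) \<Rightarrow> (- u, - v, l, l') \<in> set neighbour_states)"
  by code_simp

context cubic_base begin

definition pos_of :: "nat \<Rightarrow> pos" where
  "pos_of c = (if c < a - 2 then Low else if c = a - 2 then PreLast else if c = a - 1 then Last else End)"

lemma block_pos: "c < block_len l \<Longrightarrow> block l c = pos_letter l (pos_of c)"
  using a_ge_2 by (cases l) (auto simp: pos_of_def block_len_def)

lemma block_shift_pos: "c \<le> block_len l \<Longrightarrow> block_shift l c = pos_shift l (pos_of c)"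
  using a_ge_2 by (cases l) (auto simp: pos_of_def block_len_def)

lemma inner_pos_of: "c < block_len l \<Longrightarrow> inner_pos l (pos_of c) \<and> pos_of c \<in> {Low, PreLast, Last}"
  using a_ge_2 by (auto simp: pos_of_def block_len_def split: if_splits)

lemma next_pos_of: "c < a \<Longrightarrow> next_pos (pos_of c) (pos_of (Suc c))"
  using a_ge_2 by (auto simp: pos_of_def)

lemma end_pos_of: "pos_of (block_len l) = end_pos l"
  using a_ge_2 by (auto simp: pos_of_def block_len_def)

lemma block_last: "block l (block_len l - 1) = last_letter l"
  using a_ge_2 by (cases l) (auto simp: block_len_def)

lemma pos_shift_third: "snd (snd (pos_shift l p)) = 0"
  by (cases l) auto

lemma shift_vec_third: "snd (snd (shift_vec l)) = 0"
  by (cases l) auto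

lemma block_len_le: "block_len l \<le> a"
  by (simp add: block_len_def)

text \<open>The index of a point is its third coordinate, so a point of the orbit is determined by its class
  modulo \<open>\<int> + \<int>\<alpha>\<close>.\<close>

lemma orbit_third: "snd (snd (orbit n)) = int n"
proof (induction n)
  case (Suc n)
  then show ?case by (cases "letter_at n"; cases "orbit n") auto
qed simp

lemma alpha_pow_Suc: "alpha_pow (Suc j) = times_alpha (alpha_pow j)"
  by (simp add: alpha_pow_def)

lemma alpha_pow_2: "alpha_pow 2 = (0, 0, 1)"
  by (simp add: alpha_pow_def numeral_2_eq_2)

lemma orbit_before:
  assumes "k > 0"
  shows "orbit k = orbit (k - 1) + ((0, 0, 1) + shift_vec (letter_at (k - 1)))"
  using assms by (cases k) auto

lemma times_alpha_offset:
  assumes "u + p = v + b"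
  shows "times_alpha p = times_alpha v + times_alpha b - times_alpha u"
  using arg_cong[OF assms, of times_alpha] by (simp add: times_alpha_add algebra_simps)

lemma neighbour_step_within:
  assumes eq: "orbit m + p = orbit m' + (x, y, 0)"
    and st: "(x, y, letter_at m, letter_at m') \<in> set neighbour_states"
    and c: "c < block_len (letter_at m)"
    and c': "int c' = int c + y" "c' < block_len (letter_at m')"
  shows "\<exists>n' x' y'. orbit (block_start m + c) + times_alpha p = orbit n' + (x', y', 0)
     \<and> (x', y', letter_at (block_start m + c), letter_at n') \<in> set neighbour_states"
proof -
  obtain u v where uv: "block_shift (letter_at m) c = (u, v, 0)"
    using c by (metis block_shift_pos less_imp_le pos_shift_third prod.collapse)
  obtain u' v' where uv': "block_shift (letter_at m') c' = (u', v', 0)"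
    using c'(2) by (metis block_shift_pos less_imp_le pos_shift_third prod.collapse)
  have "orbit (block_start m + c) + times_alpha p
      = orbit (block_start m' + c') + (u - u', x + v - v', 0)"
    using c c' uv uv' times_alpha_offset[OF eq]
    by (cases "times_alpha (orbit m)"; cases "times_alpha (orbit m')") (simp add: orbit_block)
  moreover have "if y = 0 then pos_of c' = pos_of c else if y = 1 then next_pos (pos_of c) (pos_of c')
      else next_pos (pos_of c') (pos_of c)"
  proof -
    have "y = -1 \<or> y = 0 \<or> y = 1" using st neighbour_states_second by fastforce
    then have "c' = c \<and> y = 0 \<or> c' = Suc c \<and> y = 1 \<or> c = Suc c' \<and> y = -1" using c'(1) by auto
    then show ?thesis
      using next_pos_of[of c] next_pos_of[of c'] c c' block_len_le[of "letter_at m"]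
        block_len_le[of "letter_at m'"] by (auto simp del: next_pos.simps)
  qed
  then have "next_state (x, y, letter_at m, letter_at m') (pos_of c) (pos_of c') (pos_letter (letter_at m') (pos_of c'))"
    using next_state_within[OF st] inner_pos_of[OF c] inner_pos_of[OF c'(2)] by blast
  then have "(u - u', x + v - v', letter_at (block_start m + c), letter_at (block_start m' + c'))
      \<in> set neighbour_states"
    using c c' uv uv' by (simp add: letter_at_block block_pos block_shift_pos
        del: pos_letter.simps pos_shift.simps)
  ultimately show ?thesis by blast
qed

lemma neighbour_step_above:
  assumes eq: "orbit m + p = orbit m' + (x, y, 0)"
    and st: "(x, y, letter_at m, letter_at m') \<in> set neighbour_states"
    and c: "c < block_len (letter_at m)"
    and above: "int c + y \<ge> int (block_len (letter_at m'))"
  shows "\<exists>n' x' y'. orbit (block_start m + c) + times_alpha p = orbit n' + (x', y', 0)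
     \<and> (x', y', letter_at (block_start m + c), letter_at n') \<in> set neighbour_states"
proof -
  let ?l = "block_len (letter_at m')" and ?k = "letter_at (block_start (Suc m'))"
  have y: "y = -1 \<or> y = 0 \<or> y = 1" using st neighbour_states_second by fastforce
  obtain u v where uv: "block_shift (letter_at m) c = (u, v, 0)"
    using c by (metis block_shift_pos less_imp_le pos_shift_third prod.collapse)
  obtain u' v' where uv': "block_shift (letter_at m') ?l = (u', v', 0)"
    by (metis block_shift_pos order_refl pos_shift_third prod.collapse)
  have k: "?k \<in> {A, C}" "?k = A \<or> letter_at m' = A"
    using letter_at_block_start_in[of "Suc m'"] letter_at_block_start[of "Suc m'"]
      after_B[of m'] after_C[of m'] after_D[of m'] a_ge_2
    by (cases "letter_at m'"; auto)+
  have "(if y = 0 then pos_of c = end_pos (letter_at m') else if y = 1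
      then next_pos (pos_of c) (end_pos (letter_at m')) else False) \<and> int c + y = int ?l"
  proof -
    have "y = 1 \<longrightarrow> letter_at m' \<noteq> B" using st neighbour_states_second by fastforce
    then have "c = ?l \<and> y = 0 \<or> Suc c = ?l \<and> y = 1"
      using c above y by (auto simp: block_len_def split: if_splits)
    then show ?thesis using c next_pos_of[of c] end_pos_of[of "letter_at m'"] block_len_le[of "letter_at m"]
      by (auto simp del: end_pos.simps)
  qed
  note over = this
  then have "next_state (x, y, letter_at m, letter_at m') (pos_of c) (end_pos (letter_at m')) ?k"
    using next_state_above[OF st] inner_pos_of[OF c] k by blast
  then have "(u - u', x + v - v', letter_at (block_start m + c), ?k) \<in> set neighbour_states"
    using c uv uv' by (simp add: letter_at_block block_pos block_shift_pos end_pos_of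
        del: pos_letter.simps pos_shift.simps end_pos.simps)
  moreover have "orbit (block_start m + c) + times_alpha p
      = orbit (block_start (Suc m')) + (u - u', x + v - v', 0)"
    using c over uv uv' times_alpha_offset[OF eq]
    by (cases "times_alpha (orbit m)"; cases "times_alpha (orbit m')")
      (simp add: orbit_block block_start_Suc)
  ultimately show ?thesis by blast
qed

lemma neighbour_step_below:
  assumes eq: "orbit m + p = orbit m' + (x, y, 0)"
    and st: "(x, y, letter_at m, letter_at m') \<in> set neighbour_states"
    and m': "m' > 0"
    and below: "int c + y < 0"
  shows "\<exists>n' x' y'. orbit (block_start m + c) + times_alpha p = orbit n' + (x', y', 0)
     \<and> (x', y', letter_at (block_start m + c), letter_at n') \<in> set neighbour_states"
proof -
  have "y = -1 \<or> y = 0 \<or> y = 1" using st neighbour_states_second by fastforce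
  with below have y: "y = -1" and c: "c = 0" by auto
  let ?n' = "block_start m' - 1" and ?k = "letter_at (m' - 1)"
  have n': "letter_at ?n' = last_letter ?k"
    using letter_before_block[OF m'] by (simp only: block_last)
  obtain u v where uv: "shift_vec (last_letter ?k) = (u, v, 0)"
    by (metis shift_vec_third prod.collapse)
  have "block_start m' > 0" using m' block_start_gt[of m'] by simp
  then have "times_alpha (orbit m') = orbit ?n' + (u, v, 1)"
    using orbit_before[of "block_start m'"] orbit_block_start[of m'] n' uv by simp
  then have "orbit (block_start m + c) + times_alpha p = orbit ?n' + (u, x + v, 0)"
    using c y times_alpha_offset[OF eq]
    by (cases "times_alpha (orbit m)"; cases "orbit ?n'") (simp add: orbit_block_start)
  moreover have "(u, x + v, letter_at (block_start m + c), letter_at ?n') \<in> set neighbour_states"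
  proof -
    have "pos_of 0 \<in> {Low, PreLast}" by (simp add: pos_of_def)
    moreover have "letter_at m' = B \<longrightarrow> ?k = A" using before_B[of m'] by blast
    ultimately have "(u, x + v, pos_letter (letter_at m) (pos_of 0), last_letter ?k) \<in> set neighbour_states"
      using next_state_below st y uv by blast
    then show ?thesis
      using c n' uv block_len_pos by (simp add: letter_at_block_start block_pos)
  qed
  ultimately show ?thesis by blast
qed

text \<open>The bounds on the first two coordinates keep the induction for the third one going.\<close>

lemma alpha_pow_third_mono:
  assumes "j \<ge> 2"
  shows "fst (alpha_pow j) \<ge> 0 \<and> fst (snd (alpha_pow j)) \<ge> - snd (snd (alpha_pow j))
    \<and> snd (snd (alpha_pow j)) \<ge> 1 \<and> snd (snd (alpha_pow (Suc j))) \<ge> snd (snd (alpha_pow j))"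
  using assms
proof (induction j rule: dec_induct)
  case base
  show ?case using a_ge_2 unfolding alpha_pow_Suc alpha_pow_2 by simp
next
  case (step j)
  obtain p q r where pqr: "alpha_pow j = (p, q, r)" by (metis prod_cases3)
  have 1: "2 * s \<le> int a * s" if "s \<ge> 1" for s
    using a_ge_2 that by (intro mult_right_mono) auto
  show ?case using step.IH 1[of r] 1[of "q + int a * r"] by (auto simp: pqr alpha_pow_Suc)
qed

text \<open>The induction step writes \<open>n\<close> as a position \<open>c\<close> in the block of \<open>m\<close> and applies the induction
  hypothesis to \<open>m\<close>.\<close>

lemma orbit_add_alpha_pow:
  assumes "j \<ge> 2"
  shows "\<exists>n' x y. orbit n + alpha_pow j = orbit n' + (x, y, 0)
    \<and> (x, y, letter_at n, letter_at n') \<in> set neighbour_states"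
  using assms
proof (induction j arbitrary: n rule: dec_induct)
  case base
  obtain u v where uv: "shift_vec (letter_at n) = (u, v, 0)"
    by (metis shift_vec_third prod.collapse)
  have "orbit n + alpha_pow 2 = orbit (Suc n) + (- u, - v, 0)"
    using uv by (cases "orbit n") (simp add: alpha_pow_2)
  moreover have "(- u, - v, letter_at n, letter_at (Suc n)) \<in> set neighbour_states"
    using bspec[OF bspec[OF neighbour_states_start, of "letter_at n"], of "letter_at (Suc n)"] uv
      after_B[of n] after_C[of n] after_D[of n]
    by (cases "letter_at n"; cases "letter_at (Suc n)") simp_all
  ultimately show ?case by blast
next
  case (step j)
  obtain m c where mc: "n = block_start m + c" "c < block_len (letter_at m)"
    by (rule block_decomposition)
  obtain m' x y where IH: "orbit m + alpha_pow j = orbit m' + (x, y, 0)"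
    "(x, y, letter_at m, letter_at m') \<in> set neighbour_states" using step.IH by blast
  have "int m' > 0"
    using arg_cong[OF IH(1), of "\<lambda>v. snd (snd v)"] alpha_pow_third_mono[OF step.hyps(1)]
    by (simp add: orbit_third)
  then have "m' > 0" by simp
  let ?c = "int c + y"
  consider "?c < 0" | "?c \<ge> int (block_len (letter_at m'))"
    | "int (nat ?c) = ?c" "nat ?c < block_len (letter_at m')" by linarith
  then show ?case
    using neighbour_step_below[OF IH \<open>m' > 0\<close>] neighbour_step_above[OF IH mc(2)]
      neighbour_step_within[OF IH mc(2)] unfolding mc(1) alpha_pow_Suc by cases blast+
qed

section \<open>The finiteness property\<close>

lemma letter_before_block_last:
  "m > 0 \<Longrightarrow> letter_at (block_start m - 1) = last_letter (letter_at (m - 1))"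
  using letter_before_block[of m] by (simp only: block_last)

lemma block_start_pos: "m > 0 \<Longrightarrow> block_start m > 0"
  using block_start_gt[of m] by simp

lemma funpow_add_vec:
  "(times_alpha ^^ k) (u + v) = (times_alpha ^^ k) u + (times_alpha ^^ k) v"
  by (induction k) (auto simp: times_alpha_add)

lemma funpow_alpha_pow: "(times_alpha ^^ k) (alpha_pow j) = alpha_pow (k + j)"
  by (simp add: alpha_pow_def funpow_add)

lemma orbit_before_block:
  assumes "m > 0"
  shows "times_alpha (orbit m) - (0, 0, 1) =
    orbit (block_start m - 1) + shift_vec (last_letter (letter_at (m - 1)))"
  using orbit_before[OF block_start_pos[OF assms]] orbit_block_start[of m]
    letter_before_block_last[OF assms] by (simp add: algebra_simps)

text \<open>The letters at the ends of successive blocks run through \<open>C, D, A\<close>, and the increment of \<open>A\<close> is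
  exactly \<open>\<alpha>\<^sup>2\<close>.\<close>

lemma orbit_minus_one_after_C:
  assumes "n > 0" "letter_at (n - 1) = C"
  shows "\<exists>k. (times_alpha ^^ 2) (orbit n - (1, 0, 0)) = orbit k \<and> letter_at k = A"
proof -
  let ?m = "block_start n"
  have "?m > 0" using assms(1) by (rule block_start_pos)
  have D: "letter_at (?m - 1) = D" using letter_before_block_last[OF assms(1)] assms(2) by simp
  have "(times_alpha ^^ 2) (orbit n - (1, 0, 0)) = times_alpha (orbit ?m) - (0, 0, 1)"
    by (simp add: numeral_2_eq_2 times_alpha_diff orbit_block_start)
  also have "\<dots> = orbit (block_start ?m - 1)"
    using orbit_before_block[OF \<open>?m > 0\<close>] D by (cases "orbit (block_start ?m - 1)") simp
  finally show ?thesis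
    using letter_before_block_last[OF \<open>?m > 0\<close>] D by auto
qed

text \<open>These are the elements of \<open>\<int>[\<alpha>]\<close> with a finite expansion, negative exponents being allowed.\<close>

definition reaches_orbit :: "int \<times> int \<times> int \<Rightarrow> bool" where
  "reaches_orbit s \<longleftrightarrow> (\<exists>k. (times_alpha ^^ k) s \<in> range orbit)"

lemma reaches_orbit_funpow:
  assumes "reaches_orbit ((times_alpha ^^ k) s)" shows "reaches_orbit s"
  using assms unfolding reaches_orbit_def by (metis comp_apply funpow_add)

lemma reaches_orbit_times: "reaches_orbit (times_alpha s) \<Longrightarrow> reaches_orbit s"
  using reaches_orbit_funpow[of 1 s] by simp

lemma reaches_orbit_orbit: "reaches_orbit (orbit n)"
  unfolding reaches_orbit_def by (rule exI[of _ 0]) simp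

text \<open>The error term \<open>\<alpha>\<close> disappears by itself.  In the lemmas that follow, multiplication by \<open>\<alpha>\<close> removes the
  error term or turns it into one that was treated before.\<close>

lemma reaches_orbit_plus_alpha: "reaches_orbit (orbit m + (0, 1, 0))"
proof (rule reaches_orbit_times)
  let ?n = "Suc (block_start m)"
  have n: "times_alpha (orbit m + (0, 1, 0)) = orbit ?n - shift_vec (letter_at (block_start m))"
    by (simp add: times_alpha_add orbit_block_start)
  show "reaches_orbit (times_alpha (orbit m + (0, 1, 0)))"
  proof (cases "letter_at (block_start m) = A")
    case True
    then show ?thesis unfolding n using reaches_orbit_orbit[of ?n]
      by (cases "orbit ?n") simp
  next
    case False
    then have "letter_at (?n - 1) = C" using letter_at_block_start_in[of m] by simp
    from orbit_minus_one_after_C[OF _ this] obtain k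
      where "(times_alpha ^^ 2) (orbit ?n - (1, 0, 0)) = orbit k" by auto
    with \<open>letter_at (?n - 1) = C\<close> show ?thesis unfolding n
      using reaches_orbit_funpow[of 2 "orbit ?n - (1, 0, 0)"] reaches_orbit_orbit[of k]
      by (simp del: orbit.simps)
  qed
qed

lemma reaches_orbit_plus_one: "reaches_orbit (orbit m + (1, 0, 0))"
  by (rule reaches_orbit_times)
    (use reaches_orbit_plus_alpha[of "block_start m"] in \<open>simp add: times_alpha_add orbit_block_start\<close>)

lemma reaches_orbit_after_B:
  assumes "letter_at m = B"
  shows "reaches_orbit (orbit m + (1, -1, 0))"
proof (rule reaches_orbit_times)
  have m: "m > 0" "letter_at (m - 1) = A" using before_B[OF assms] by auto
  have "times_alpha (orbit m + (1, -1, 0)) = times_alpha (orbit m) - (0, 0, 1) + (0, 1, 0)"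
    by (cases "orbit m") simp
  also have "\<dots> = orbit (block_start m - 1) + (1, 0, 0)"
    unfolding orbit_before_block[OF m(1)] m(2) by (cases "orbit (block_start m - 1)") simp
  finally show "reaches_orbit (times_alpha (orbit m + (1, -1, 0)))"
    using reaches_orbit_plus_one by metis
qed

lemma reaches_orbit_minus_alpha:
  assumes "m > 0"
  shows "reaches_orbit (orbit m + (0, -1, 0))"
proof (rule reaches_orbit_times)
  let ?n = "block_start m - 1"
  have "times_alpha (orbit m + (0, -1, 0)) = times_alpha (orbit m) - (0, 0, 1)"
    by (cases "orbit m") simp
  also have "\<dots> = orbit ?n + shift_vec (letter_at ?n)"
    unfolding orbit_before_block[OF assms] letter_before_block_last[OF assms] ..
  finally show "reaches_orbit (times_alpha (orbit m + (0, -1, 0)))"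
    using reaches_orbit_orbit[of ?n] reaches_orbit_plus_one[of ?n] reaches_orbit_after_B[of ?n]
    by (cases "letter_at ?n"; cases "orbit ?n") auto
qed

lemma reaches_orbit_minus_one:
  assumes "m > 0"
  shows "reaches_orbit (orbit m + (-1, 0, 0))"
proof (rule reaches_orbit_times)
  have "times_alpha (orbit m + (-1, 0, 0)) = orbit (block_start m) + (0, -1, 0)"
    by (simp add: times_alpha_add orbit_block_start)
  then show "reaches_orbit (times_alpha (orbit m + (-1, 0, 0)))"
    using reaches_orbit_minus_alpha[OF block_start_pos[OF assms]] by simp
qed

lemma reaches_orbit_alpha_minus_one:
  assumes "letter_at m \<in> {A, C}"
  shows "reaches_orbit (orbit m + (-1, 1, 0))"
proof (rule reaches_orbit_times)
  let ?n = "Suc (block_start m)"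
  have "letter_at (block_start m) = A"
    using assms a_ge_2 by (auto simp: letter_at_block_start)
  then have "times_alpha (orbit m + (-1, 1, 0)) = orbit ?n + (0, -1, 0)"
    by (cases "times_alpha (orbit m)") (simp add: times_alpha_add orbit_block_start)
  then show "reaches_orbit (times_alpha (orbit m + (-1, 1, 0)))"
    using reaches_orbit_minus_alpha[of ?n] by (simp del: orbit.simps)
qed

lemma reaches_orbit_neighbour:
  assumes "(x, y, l, letter_at m) \<in> set neighbour_states" "m > 0"
  shows "reaches_orbit (orbit m + (x, y, 0))"
proof -
  have "x = 0 \<and> y = 0 \<or> x = 1 \<and> y = 0 \<or> x = -1 \<and> y = 0 \<or> x = 0 \<and> y = 1 \<or> x = 0 \<and> y = -1
    \<or> x = -1 \<and> y = 1 \<and> letter_at m \<in> {A, C} \<or> x = 1 \<and> y = -1 \<and> letter_at m = B"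
    using assms(1) by (auto simp: neighbour_states_def)
  then show ?thesis
    using reaches_orbit_orbit[of m] reaches_orbit_plus_alpha[of m] reaches_orbit_plus_one[of m]
      reaches_orbit_after_B[of m] reaches_orbit_minus_alpha[OF assms(2)]
      reaches_orbit_minus_one[OF assms(2)] reaches_orbit_alpha_minus_one[of m]
    by (elim disjE) (auto simp flip: zero_prod_def)
qed

lemma orbit_add_alpha_pow':
  assumes "j \<ge> 2"
  obtains n' x y where "n' > n" "orbit n + alpha_pow j = orbit n' + (x, y, 0)"
    "(x, y, letter_at n, letter_at n') \<in> set neighbour_states"
proof -
  obtain n' x y where *: "orbit n + alpha_pow j = orbit n' + (x, y, 0)"
    "(x, y, letter_at n, letter_at n') \<in> set neighbour_states"
    using orbit_add_alpha_pow[OF assms] by blast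
  moreover have "n' > n"
    using arg_cong[OF *(1), of "\<lambda>v. snd (snd v)"] alpha_pow_third_mono[OF assms]
    by (simp add: orbit_third)
  ultimately show ?thesis using that by blast
qed

lemma reaches_orbit_add_alpha_pow:
  assumes "reaches_orbit s"
  shows "reaches_orbit (s + alpha_pow j)"
proof -
  obtain k n where "(times_alpha ^^ k) s = orbit n"
    using assms by (auto simp: reaches_orbit_def)
  then have "(times_alpha ^^ (2 + k)) s = orbit (block_start (block_start n))"
    by (simp add: numeral_2_eq_2 orbit_block_start)
  moreover have "2 \<le> 2 + k + j" by simp
  from orbit_add_alpha_pow'[OF this, of "block_start (block_start n)"] obtain m x y
    where m: "m > block_start (block_start n)"
    "orbit (block_start (block_start n)) + alpha_pow (2 + k + j) = orbit m + (x, y, 0)"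
    "(x, y, letter_at (block_start (block_start n)), letter_at m) \<in> set neighbour_states"
    by blast
  ultimately have "(times_alpha ^^ (2 + k)) (s + alpha_pow j) = orbit m + (x, y, 0)"
    by (simp only: funpow_add_vec funpow_alpha_pow)
  then show ?thesis
    using reaches_orbit_neighbour[OF m(3)] m(1) reaches_orbit_funpow[of "2 + k" "s + alpha_pow j"] by auto
qed

end

lemma sum_const_triple:
  "(\<Sum>i<N. (p, q, r)) = (int N * p, int N * q, int N * r)"
  by (induction N) (auto simp: algebra_simps zero_prod_def)

lemma (in cubic_base) reaches_orbit_add_multiple:
  "reaches_orbit s \<Longrightarrow> reaches_orbit (s + (\<Sum>i<(N::nat). alpha_pow j))"
proof (induction N)
  case (Suc N)
  then show ?case
    using reaches_orbit_add_alpha_pow[of "s + (\<Sum>i<N. alpha_pow j)" j] by (simp add: add.assoc)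
qed simp

text \<open>The vectors \<open>1\<close>, \<open>\<alpha>\<^sup>2 - \<alpha>\<close> and \<open>\<alpha>\<^sup>2\<close> form a basis of \<open>\<int>[\<alpha>]\<close>, and the hypotheses say that the coordinates in it
  are nonnegative.  The basis \<open>1, \<alpha>, \<alpha>\<^sup>2\<close> itself would be useless here, because large positive
  elements have a negative middle coordinate.\<close>

lemma (in cubic_base) reaches_orbit_nonneg_comb:
  assumes "p \<ge> 0" "q \<le> 0" "q + r \<ge> 0"
  shows "reaches_orbit (p, q, r)"
proof -
  obtain P where P: "p = int P" using assms(1) nonneg_int_cases by blast
  obtain Q where Q: "q = - int Q" using assms(2) nonpos_int_cases by blast
  obtain R where R: "q + r = int R" using assms(3) nonneg_int_cases by blast
  \<comment> \<open>After multiplication by \<open>\<alpha>\<^sup>2\<close>, the middle basis vector is \<open>(a - 2)\<alpha>\<^sup>3 + (a - 1)\<alpha>\<^sup>2 + 1\<close>.\<close>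
  have pows: "alpha_pow 0 = (1, 0, 0)" "alpha_pow 2 = (0, 0, 1)"
    "alpha_pow 3 = (1, -1, int a)" "alpha_pow 4 = (int a, 1 - int a, int a * int a - 1)"
    by (simp_all add: alpha_pow_def eval_nat_numeral)
  have "reaches_orbit (0 + (\<Sum>i<P. alpha_pow 2) + (\<Sum>i<Q * (a - 2). alpha_pow 3)
     + (\<Sum>i<Q * (a - 1). alpha_pow 2) + (\<Sum>i<Q. alpha_pow 0) + (\<Sum>i<R. alpha_pow 4))"
    using reaches_orbit_orbit[of 0]
    by (intro reaches_orbit_add_multiple) (simp add: zero_prod_def)
  also have "0 + (\<Sum>i<P. alpha_pow 2) + (\<Sum>i<Q * (a - 2). alpha_pow 3)
     + (\<Sum>i<Q * (a - 1). alpha_pow 2) + (\<Sum>i<Q. alpha_pow 0) + (\<Sum>i<R. alpha_pow 4)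
     = (times_alpha ^^ 2) (p, q, r)"
  proof -
    have r: "r = int R + int Q" using Q R by simp
    obtain d where d: "a = d + 2" using a_ge_2 by (metis add.commute le_Suc_ex)
    have sq: "(times_alpha ^^ 2) (p, q, r) = (q + int a * r, r - (q + int a * r), p - r + int a * (q + int a * r))"
      by (simp add: numeral_2_eq_2)
    show ?thesis unfolding pows sum_const_triple sq
      by (simp add: P Q r d algebra_simps zero_prod_def)
  qed
  finally show ?thesis by (rule reaches_orbit_funpow)
qed

section \<open>The two embeddings of the cubic ring\<close>

locale cubic_roots = cubic_base +
  fixes \<beta> :: real and \<alpha> :: complex
  assumes alpha_root: "\<alpha> ^ 3 = of_nat a * \<alpha> ^ 2 - \<alpha> + 1"
    and beta_root: "\<beta> ^ 3 = of_nat a * \<beta> ^ 2 - \<beta> + 1"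
    and Re_alpha: "2 * Re \<alpha> = real a - \<beta>"
    and norm_alpha: "(cmod \<alpha>)\<^sup>2 * \<beta> = 1"
    and beta_gt_1: "\<beta> > 1"
    and Im_alpha: "Im \<alpha> \<noteq> 0"
    and norm_alpha_lt_1: "cmod \<alpha> < 1"
begin

fun cval :: "int \<times> int \<times> int \<Rightarrow> complex" where
  "cval (p, q, r) = of_int p + of_int q * \<alpha> + of_int r * \<alpha>\<^sup>2"

fun bval :: "int \<times> int \<times> int \<Rightarrow> real" where
  "bval (p, q, r) = of_int p + of_int q * \<beta> + of_int r * \<beta>\<^sup>2"

lemma cval_add: "cval (u + v) = cval u + cval v"
  by (cases u; cases v) (simp add: algebra_simps)

lemma bval_add: "bval (u + v) = bval u + bval v"
  by (cases u; cases v) (simp add: algebra_simps)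

lemma cval_diff: "cval (u - v) = cval u - cval v"
  by (cases u; cases v) (simp add: algebra_simps)

lemma cval_times_alpha: "cval (times_alpha u) = \<alpha> * cval u"
proof (cases u)
  case (fields p q r)
  have h: "\<alpha> * \<alpha>\<^sup>2 = of_nat a * \<alpha>\<^sup>2 - \<alpha> + 1"
    using alpha_root by (simp add: power3_eq_cube power2_eq_square mult.assoc)
  have "\<alpha> * cval u = of_int p * \<alpha> + of_int q * \<alpha>\<^sup>2 + of_int r * (\<alpha> * \<alpha>\<^sup>2)"
    unfolding fields by (simp add: algebra_simps power2_eq_square)
  then show ?thesis unfolding h by (simp add: fields algebra_simps)
qed

lemma bval_times_alpha: "bval (times_alpha u) = \<beta> * bval u"
proof (cases u)
  case (fields p q r)
  have h: "\<beta> * \<beta>\<^sup>2 = of_nat a * \<beta>\<^sup>2 - \<beta> + 1"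
    using beta_root by (simp add: power3_eq_cube power2_eq_square mult.assoc)
  have "\<beta> * bval u = of_int p * \<beta> + of_int q * \<beta>\<^sup>2 + of_int r * (\<beta> * \<beta>\<^sup>2)"
    unfolding fields by (simp add: algebra_simps power2_eq_square)
  then show ?thesis unfolding h by (simp add: fields algebra_simps)
qed

lemma cval_funpow: "cval ((times_alpha ^^ k) u) = \<alpha> ^ k * cval u"
  by (induction k) (auto simp: cval_times_alpha)

lemma bval_funpow: "bval ((times_alpha ^^ k) u) = \<beta> ^ k * bval u"
  by (induction k) (auto simp: bval_times_alpha)

lemma alpha_nz: "\<alpha> \<noteq> 0" using Im_alpha by auto

text \<open>This is \<open>\<alpha> + \<gamma>\<close>, the trace of the complex pair.\<close>

definition trace_gap :: real where "trace_gap = real a - \<beta>"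

lemma trace_gap: "trace_gap * \<beta> = 1 - 1 / \<beta>" "0 < trace_gap" "trace_gap < 1"
proof -
  have "(real a - \<beta>) * \<beta> * \<beta> = \<beta> - 1"
    using beta_root by (simp add: algebra_simps power2_eq_square power3_eq_cube)
  then have 1: "trace_gap * \<beta> * \<beta> = \<beta> - 1" by (simp add: trace_gap_def)
  then show 2: "trace_gap * \<beta> = 1 - 1 / \<beta>" using beta_gt_1 by (simp add: field_simps)
  from 2 have 3: "trace_gap = (1 - 1 / \<beta>) / \<beta>" using beta_gt_1 by (simp add: field_simps)
  show "0 < trace_gap" unfolding 3 using beta_gt_1 by simp
  have "1 - 1 / \<beta> < \<beta>" using beta_gt_1 by (smt (verit) divide_pos_pos)
  then show "trace_gap < 1" unfolding 3 using beta_gt_1 by (simp add: divide_simps)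
qed

text \<open>The integer coordinates are recovered from the two embeddings.  The last factor is the derivative
  of \<open>x\<^sup>3 - ax\<^sup>2 + x - 1\<close> at \<open>\<beta>\<close>; when the complex embedding is small, all three coordinates are
  almost proportional to the real one, with signs \<open>+, -, +\<close>.\<close>

lemma coordinates:
  fixes p q r :: int
  defines "z \<equiv> cval (p, q, r)"
  defines "d \<equiv> Im z / Im \<alpha>"
  shows "of_int q = d - trace_gap * of_int r"
    and "of_int p = Re z - d * Re \<alpha> + of_int r / \<beta>"
    and "bval (p, q, r) = Re z - d * Re \<alpha> + \<beta> * d + (\<beta>\<^sup>2 - 1 + 2 / \<beta>) * of_int r"
proof -
  have tg: "trace_gap = 2 * Re \<alpha>" using Re_alpha by (simp add: trace_gap_def)
  have im: "Im (\<alpha>\<^sup>2) = trace_gap * Im \<alpha>"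
    unfolding tg by (simp add: power2_eq_square)
  have n: "(Re \<alpha>)\<^sup>2 + (Im \<alpha>)\<^sup>2 = 1 / \<beta>"
    using norm_alpha beta_gt_1 by (simp add: cmod_power2 field_simps)
  have re: "Re (\<alpha>\<^sup>2) = trace_gap * Re \<alpha> - 1 / \<beta>"
    unfolding tg n[symmetric] by (simp add: power2_eq_square)
  have "Im z = Im \<alpha> * (of_int q + trace_gap * of_int r)"
    using im by (simp add: z_def algebra_simps)
  then have d: "d = of_int q + trace_gap * of_int r"
    using Im_alpha by (simp add: d_def)
  then show q: "of_int q = d - trace_gap * of_int r" by simp
  have "Re z = of_int p + of_int q * Re \<alpha> + of_int r * (trace_gap * Re \<alpha> - 1 / \<beta>)"
    using re by (simp add: z_def)
  then show p: "of_int p = Re z - d * Re \<alpha> + of_int r / \<beta>"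
    unfolding d by (simp add: algebra_simps)
  have "bval (p, q, r) = Re z - d * Re \<alpha> + \<beta> * d + (1 / \<beta> - trace_gap * \<beta> + \<beta>\<^sup>2) * of_int r"
    by (simp add: p q algebra_simps)
  also have "1 / \<beta> - trace_gap * \<beta> + \<beta>\<^sup>2 = \<beta>\<^sup>2 - 1 + 2 / \<beta>"
    unfolding trace_gap(1) by simp
  finally show "bval (p, q, r) = Re z - d * Re \<alpha> + \<beta> * d + (\<beta>\<^sup>2 - 1 + 2 / \<beta>) * of_int r" .
qed

lemma leading_pos: "\<beta>\<^sup>2 - 1 + 2 / \<beta> > 0"
proof -
  have "\<beta>\<^sup>2 > 1" using beta_gt_1 by (simp add: power2_eq_square less_1_mult)
  then show ?thesis using beta_gt_1 by (smt (verit) divide_pos_pos)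
qed

lemma coordinate_errors:
  fixes p q r :: int
  defines "z \<equiv> cval (p, q, r)"
  defines "d \<equiv> Im z / Im \<alpha>"
  assumes "cmod z \<le> K" 
  defines "E \<equiv> K * (1 + (1 + \<beta>) / \<bar>Im \<alpha>\<bar>)"
  shows "\<bar>d\<bar> \<le> E" "\<bar>Re z - d * Re \<alpha>\<bar> \<le> E" "\<bar>Re z - d * Re \<alpha> + \<beta> * d\<bar> \<le> E"
proof -
  have K: "K \<ge> 0" using assms(3) norm_ge_zero order_trans by blast
  have d: "\<bar>d\<bar> \<le> K / \<bar>Im \<alpha>\<bar>"
    using abs_Im_le_cmod[of z] assms(3) Im_alpha by (simp add: d_def divide_right_mono)
  have re: "\<bar>Re z\<bar> \<le> K" using abs_Re_le_cmod[of z] assms(3) by simp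
  have ra: "\<bar>d * Re \<alpha>\<bar> \<le> K / \<bar>Im \<alpha>\<bar>"
  proof -
    have "\<bar>Re \<alpha>\<bar> \<le> 1" using abs_Re_le_cmod[of \<alpha>] norm_alpha_lt_1 by simp
    then have "\<bar>d\<bar> * \<bar>Re \<alpha>\<bar> \<le> \<bar>d\<bar> * 1" by (intro mult_left_mono) auto
    with d show ?thesis by (simp add: abs_mult)
  qed
  have bd: "\<bar>\<beta> * d\<bar> \<le> \<beta> * (K / \<bar>Im \<alpha>\<bar>)"
    using mult_left_mono[OF d, of \<beta>] beta_gt_1 by (simp add: abs_mult)
  have E: "E = K + K / \<bar>Im \<alpha>\<bar> + \<beta> * (K / \<bar>Im \<alpha>\<bar>)"
    by (simp add: E_def algebra_simps add_divide_distrib)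
  have nn: "K / \<bar>Im \<alpha>\<bar> \<ge> 0" "\<beta> * (K / \<bar>Im \<alpha>\<bar>) \<ge> 0" using K beta_gt_1 by auto
  show "\<bar>d\<bar> \<le> E" "\<bar>Re z - d * Re \<alpha>\<bar> \<le> E" "\<bar>Re z - d * Re \<alpha> + \<beta> * d\<bar> \<le> E"
    using d re ra bd nn K unfolding E by linarith+
qed

text \<open>Multiplication by \<open>\<alpha>\<^sup>k\<close> does not enlarge the complex embedding, while the real one grows like
  \<open>\<beta>\<^sup>k\<close>.  So for large \<open>k\<close> the coordinates have the signs required by
  \<open>reaches_orbit_nonneg_comb\<close>.\<close>

lemma reaches_orbit_if_positive:
  assumes "bval s > 0"
  shows "reaches_orbit s"
proof -
  define E where "E = cmod (cval s) * (1 + (1 + \<beta>) / \<bar>Im \<alpha>\<bar>)"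
  define N where "N = \<beta>\<^sup>2 - 1 + 2 / \<beta>"
  \<comment> \<open>Beyond \<open>R\<close> the third coordinate dominates the error \<open>E\<close> in each of the three sign conditions.\<close>
  define R where "R = Max {\<beta> * E, E / trace_gap, E / (1 - trace_gap)}"
  obtain k where "(E + N * R) / bval s < \<beta> ^ k"
    using real_arch_pow[OF beta_gt_1] by blast
  then have k: "\<beta> ^ k * bval s > E + N * R" using assms by (simp add: field_simps)
  obtain p q r where pqr: "(times_alpha ^^ k) s = (p, q, r)" by (metis prod_cases3)
  let ?z = "cval (p, q, r)"
  have z: "cmod ?z \<le> cmod (cval s)"
    using norm_alpha_lt_1 unfolding pqr[symmetric] cval_funpow norm_mult norm_power
    by (intro mult_left_le_one_le) (auto simp: power_le_one)
  note err = coordinate_errors[OF z, folded E_def]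
  note co = coordinates[where p = p and q = q and r = r, folded N_def]
  have "N * of_int r > N * R"
    using k err(3) unfolding bval_funpow[symmetric] pqr co(3) by linarith
  then have r: "of_int r > R" using leading_pos by (simp add: N_def)
  then have "of_int r > \<beta> * E" "of_int r > E / trace_gap" "of_int r > E / (1 - trace_gap)"
    by (auto simp: R_def)
  then have r3: "of_int r / \<beta> > E" "trace_gap * of_int r > E" "(1 - trace_gap) * of_int r > E"
    using beta_gt_1 trace_gap by (auto simp: field_simps)
  have "real_of_int p \<ge> 0" using co(2) err(2) r3(1) by linarith
  moreover have "real_of_int q \<le> 0" using co(1) err(1) r3(2) by linarith
  moreover have "real_of_int (q + r) \<ge> 0"
    using co(1) err(1) r3(3) unfolding of_int_add left_diff_distrib by linarith
  ultimately have "reaches_orbit (p, q, r)" by (intro reaches_orbit_nonneg_comb) linarith+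
  then show ?thesis using reaches_orbit_funpow[of k s] pqr by simp
qed

text \<open>\<open>\<int>[\<alpha>]\<close> is a lattice in \<open>\<complex> \<times> \<real>\<close>.\<close>

lemma finite_bounded_triples:
  "finite {s. cmod (cval s) \<le> K \<and> \<bar>bval s\<bar> \<le> K'}"
proof -
  define E where "E = K * (1 + (1 + \<beta>) / \<bar>Im \<alpha>\<bar>)"
  define N where "N = \<beta>\<^sup>2 - 1 + 2 / \<beta>"
  define X where "X = (K' + E) / N + 2 * E"
  have fin: "finite {i :: int. \<bar>of_int i :: real\<bar> \<le> X}"
  proof (rule finite_subset)
    show "{i :: int. \<bar>of_int i :: real\<bar> \<le> X} \<subseteq> {- \<lceil>X\<rceil>..\<lceil>X\<rceil>}"
    proof safe
      fix i :: int assume "\<bar>of_int i :: real\<bar> \<le> X"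
      then have "real_of_int i \<le> of_int \<lceil>X\<rceil>" "real_of_int (- \<lceil>X\<rceil>) \<le> of_int i"
        using le_of_int_ceiling[of X] unfolding of_int_minus by linarith+
      then show "i \<in> {- \<lceil>X\<rceil>..\<lceil>X\<rceil>}" unfolding of_int_le_iff by simp
    qed
  qed simp
  have "s \<in> {i. \<bar>of_int i :: real\<bar> \<le> X} \<times> {i. \<bar>of_int i :: real\<bar> \<le> X} \<times> {i. \<bar>of_int i :: real\<bar> \<le> X}"
    if "cmod (cval s) \<le> K" "\<bar>bval s\<bar> \<le> K'" for s
  proof (cases s)
    case (fields p q r)
    have z: "cmod (cval (p, q, r)) \<le> K" using that fields by simp
    note err = coordinate_errors[OF z, folded E_def]
    note co = coordinates[where p = p and q = q and r = r, folded N_def]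
    have N: "N > 0" using leading_pos by (simp add: N_def)
    have E: "E \<ge> 0" using err(1) by linarith
    have "\<bar>N * of_int r\<bar> \<le> K' + E"
      using that(2) err(3) unfolding fields co(3) by linarith
    then have r: "\<bar>of_int r :: real\<bar> \<le> (K' + E) / N"
      using N by (simp add: abs_mult field_simps)
    have "\<bar>trace_gap * of_int r\<bar> \<le> (K' + E) / N"
    proof -
      have "trace_gap * \<bar>of_int r\<bar> \<le> 1 * \<bar>of_int r :: real\<bar>"
        using trace_gap by (intro mult_right_mono) auto
      with r trace_gap show ?thesis by (simp add: abs_mult)
    qed
    moreover have "\<bar>of_int r / \<beta>\<bar> \<le> (K' + E) / N"
    proof -
      have "\<bar>of_int r / \<beta>\<bar> \<le> \<bar>of_int r :: real\<bar>"
        using beta_gt_1 mult_left_mono[of 1 \<beta> "\<bar>of_int r\<bar>"] by (simp add: abs_divide divide_le_eq)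
      with r show ?thesis by linarith
    qed
    ultimately have "\<bar>of_int p :: real\<bar> \<le> X" "\<bar>of_int q :: real\<bar> \<le> X" "\<bar>of_int r :: real\<bar> \<le> X"
      using co(1,2) err(1,2) r E unfolding X_def by linarith+
    then show ?thesis using fields by simp
  qed
  then have "{s. cmod (cval s) \<le> K \<and> \<bar>bval s\<bar> \<le> K'} \<subseteq>
     {i. \<bar>of_int i :: real\<bar> \<le> X} \<times> {i. \<bar>of_int i :: real\<bar> \<le> X} \<times> {i. \<bar>of_int i :: real\<bar> \<le> X}" by blast
  with fin show ?thesis by (meson finite_SigmaI finite_subset)
qed

lemma vals_zero:
  assumes "cval s = 0" "bval s = 0" shows "s = 0"
proof (cases s)
  case (fields p q r)
  have z: "cval (p, q, r) = 0" "bval (p, q, r) = 0" using assms fields by auto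
  note co = coordinates[where p = p and q = q and r = r, unfolded z]
  have "r = 0" using co(3) leading_pos by simp
  then show ?thesis using co(1,2) by (simp add: fields zero_prod_def)
qed

end

context cubic_base begin

section \<open>Greedy words\<close>

text \<open>States 0 and 1 accept; the state counts how much of the forbidden pattern \<open>(a - 1)(a - 1)01\<close> has been
  read, from the highest digit downwards.  State 4 is the error state.  States 2 and 3 do not accept,
  because the last digits of a word are bound by the stricter conditions on \<open>w 4\<close>, \<open>w 3\<close>, \<open>w 2\<close>.\<close>

definition digit_step :: "nat \<Rightarrow> nat \<Rightarrow> nat" where
  "digit_step c s =
    (if s \<le> 1 \<and> c < a - 1 then 0 else if s \<le> 1 \<and> c = a - 1 then Suc s
     else if s = 2 \<and> c = 0 then 3 else if s = 3 \<and> c = 0 then 0 else 4)"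

definition digit_state :: "nat list \<Rightarrow> nat" where
  "digit_state ws = foldr digit_step ws 0"

text \<open>The head of the list is the digit of the lowest exponent \<open>2\<close>.\<close>

primrec digit_val :: "nat list \<Rightarrow> int \<times> int \<times> int" where
  "digit_val [] = 0"
| "digit_val (c # ws) = times_alpha (digit_val ws) + (0, 0, int c)"

lemma digit_state_Nil [simp]: "digit_state [] = 0"
  and digit_state_Cons: "digit_state (c # ws) = digit_step c (digit_state ws)"
  by (simp_all add: digit_state_def)

lemma digit_val_append:
  "digit_val (us @ ws) = digit_val us + (times_alpha ^^ length us) (digit_val ws)"
  by (induction us) (simp_all add: times_alpha_add algebra_simps)

lemma times_alpha_0 [simp]: "times_alpha 0 = 0"
  by (simp add: zero_prod_def)

lemma digit_step_le_3: "digit_step c s \<le> 3 \<Longrightarrow> s \<le> 3 \<and> c \<le> a - 1"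
  by (auto simp: digit_step_def split: if_splits)

text \<open>Each state determines the digits that were read last.\<close>

lemma greedy_digit_state_invariant:
  assumes "greedy_G_expansion a N w" "2 \<le> k" "k \<le> Suc N"
  defines "s \<equiv> digit_state (map w [k..<Suc N])"
  shows "s \<le> 3 \<and> (s = 1 \<longrightarrow> k \<le> N \<and> w k = a - 1)
    \<and> (s = 2 \<longrightarrow> k + 1 \<le> N \<and> w k = a - 1 \<and> w (k + 1) = a - 1)
    \<and> (s = 3 \<longrightarrow> k + 2 \<le> N \<and> w k = 0 \<and> w (k + 1) = a - 1 \<and> w (k + 2) = a - 1)"
  unfolding s_def using assms(3,2)
proof (induction k rule: inc_induct)
  case base
  show ?case by simp
next
  case (step k)
  define s s' where "s = digit_state (map w [k..<Suc N])" and "s' = digit_state (map w [Suc k..<Suc N])"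
  have s: "s = digit_step (w k) s'"
    unfolding s_def s'_def using step.hyps by (simp add: upt_conv_Cons digit_state_Cons del: upt_Suc)
  have kN: "k \<le> N" using step.hyps by simp
  have wk: "w k \<le> a - 1"
    using assms(1) step.hyps step.prems by (auto simp: greedy_G_expansion_def)
  have win: "([w i, w (i - 1), w (i - 2), w (i - 3)], [a - 1, a - 1, 0, 1]) \<in> lex less_than"
    if "5 \<le> i" "i \<le> N" for i
    using assms(1) that by (auto simp: greedy_G_expansion_def)
  have low: "4 \<le> N \<longrightarrow> ([w 4, w 3, w 2], [a - 1, a - 1, 0]) \<in> lex less_than"
    using assms(1) by (auto simp: greedy_G_expansion_def)
  have IH: "s' \<le> 3" "s' = 1 \<Longrightarrow> k + 1 \<le> N \<and> w (k + 1) = a - 1"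
    "s' = 2 \<Longrightarrow> k + 2 \<le> N \<and> w (k + 1) = a - 1 \<and> w (k + 2) = a - 1"
    "s' = 3 \<Longrightarrow> k + 3 \<le> N \<and> w (k + 1) = 0 \<and> w (k + 2) = a - 1 \<and> w (k + 3) = a - 1"
    using step.IH step.prems by (simp_all add: s'_def numeral_eq_Suc del: upt_Suc)
  have "s \<le> 3 \<and> (s = 1 \<longrightarrow> k \<le> N \<and> w k = a - 1)
    \<and> (s = 2 \<longrightarrow> k + 1 \<le> N \<and> w k = a - 1 \<and> w (k + 1) = a - 1)
    \<and> (s = 3 \<longrightarrow> k + 2 \<le> N \<and> w k = 0 \<and> w (k + 1) = a - 1 \<and> w (k + 2) = a - 1)"
  proof -
    consider "s' = 0" | "s' = 1" | "s' = 2" | "s' = 3" using IH(1) by linarith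
    then show ?thesis
    proof cases
      case 1
      then have "s = (if w k = a - 1 then 1 else 0)" using wk by (simp add: s digit_step_def)
      then show ?thesis using kN by simp
    next
      case 2
      then have "s = (if w k = a - 1 then 2 else 0)" using wk by (simp add: s digit_step_def)
      then show ?thesis using IH(2)[OF 2] by simp
    next
      case 3
      note i = IH(3)[OF 3]
      have "w k = 0"
      proof (cases "k = 2")
        case True
        with i low show ?thesis by (simp add: numeral_eq_Suc)
      next
        case False
        with i step.prems win[of "k + 2"] show ?thesis by simp
      qed
      then have "s = 3" using 3 by (simp add: s digit_step_def)
      with i \<open>w k = 0\<close> show ?thesis by simp
    next
      case 4
      note i = IH(4)[OF 4]
      moreover have "k + 3 - 1 = k + 2" "k + 3 - 2 = k + 1" "k + 3 - 3 = k" by simp_all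
      ultimately have "w k = 0" using step.prems win[of "k + 3"] by simp
      then have "s = 0" using 4 by (simp add: s digit_step_def)
      then show ?thesis by simp
    qed
  qed
  then show ?case unfolding s_def .
qed

lemma greedy_imp_digit_state:
  assumes "greedy_G_expansion a N w"
  shows "digit_state (map w [2..<Suc N]) \<le> 1"
proof (cases "N \<ge> 1")
  case True
  let ?s = "digit_state (map w [2..<Suc N])"
  have inv: "?s \<le> 3" "?s = 2 \<longrightarrow> 3 \<le> N \<and> w 2 = a - 1 \<and> w 3 = a - 1"
    "?s = 3 \<longrightarrow> 4 \<le> N \<and> w 2 = 0 \<and> w 3 = a - 1 \<and> w 4 = a - 1"
    using greedy_digit_state_invariant[OF assms, of 2] True by (simp_all add: numeral_eq_Suc del: upt_Suc)
  have "?s \<noteq> 2" using inv(2) assms by (auto simp: greedy_G_expansion_def)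
  moreover have "?s \<noteq> 3" using inv(3) assms by (auto simp: greedy_G_expansion_def)
  ultimately show ?thesis using inv(1) by linarith
qed simp

lemma digit_state_imp_greedy:
  assumes "digit_state (map w [2..<Suc N]) \<le> 1"
  shows "greedy_G_expansion a N w"
proof -
  define st where "st k = digit_state (map w [k..<Suc N])" for k
  have st: "st k = digit_step (w k) (st (Suc k))" if "k \<le> N" for k
    using that by (simp add: st_def upt_conv_Cons digit_state_Cons del: upt_Suc)
  have st3: "st k \<le> 3" if "2 \<le> k" for k
    using that
  proof (induction k rule: dec_induct)
    case base then show ?case using assms by (simp add: st_def)
  next
    case (step k)
    then show ?case using st[of k] digit_step_le_3[of "w k" "st (Suc k)"]
      by (cases "k \<le> N") (auto simp: st_def)
  qed
  have dig: "w k \<le> a - 1" if "2 \<le> k" "k \<le> N" for k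
    using digit_step_le_3[of "w k" "st (Suc k)"] st3[of k] st[of k] that by simp
  have run: "st k = 2" if "2 \<le> k" "Suc k \<le> N" "w (Suc k) = a - 1" "w k = a - 1" for k
    using st[of k] st[of "Suc k"] st3[of k] st3[of "Suc k"] that a_ge_2
    by (auto simp: digit_step_def split: if_splits)
  have after2: "w k = 0 \<and> st k = 3" if "2 \<le> k" "k \<le> N" "st (Suc k) = 2" for k
    using st[of k] st3[of k] that by (auto simp: digit_step_def split: if_splits)
  have after3: "w k = 0" if "2 \<le> k" "k \<le> N" "st (Suc k) = 3" for k
    using st[of k] st3[of k] that by (auto simp: digit_step_def split: if_splits)
  show ?thesis
    unfolding greedy_G_expansion_def
  proof (intro conjI ballI impI)
    fix i assume "i \<in> {2..N}" then show "w i \<in> {0..a - 1}" using dig by auto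
  next
    fix i assume i: "i \<in> {5..N}"
    then obtain k where k: "i = k + 3" "2 \<le> k" by (intro that[of "i - 3"]) auto
    have ws: "w (i - 1) = w (k + 2)" "w (i - 2) = w (k + 1)" "w (i - 3) = w k"
      using k(1) by (simp_all add: numeral_eq_Suc)
    have "w (k + 1) = 0 \<and> w k = 0" if "w (k + 3) = a - 1" "w (k + 2) = a - 1"
    proof -
      have "st (k + 2) = 2" using run[of "k + 2"] that k i by (simp add: numeral_eq_Suc)
      then have "w (k + 1) = 0 \<and> st (k + 1) = 3" using after2[of "k + 1"] k i by simp
      then show ?thesis using after3[of k] k i by simp
    qed
    moreover have "w (k + 3) \<le> a - 1" "w (k + 2) \<le> a - 1" using dig k i by auto
    ultimately show "([w i, w (i - 1), w (i - 2), w (i - 3)], [a - 1, a - 1, 0, 1]) \<in> lex less_than"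
      unfolding ws k(1) by auto
  next
    assume N: "3 \<le> N"
    have "\<not> (w 3 = a - 1 \<and> w 2 = a - 1)"
      using run[of 2] N assms by (auto simp: st_def numeral_eq_Suc)
    then show "([w 3, w 2], [a - 1, a - 1]) \<in> lex less_than"
      using dig[of 2] dig[of 3] N by auto
  next
    assume N: "4 \<le> N"
    have "\<not> (w 4 = a - 1 \<and> w 3 = a - 1)"
      using run[of 3] after2[of 2] N assms by (auto simp: st_def numeral_eq_Suc simp del: upt_Suc)
    then show "([w 4, w 3, w 2], [a - 1, a - 1, 0]) \<in> lex less_than"
      using dig[of 3] dig[of 4] N by auto
  qed
qed

lemma orbit_digit_below:
  assumes "c < (if letter_at n \<in> {A, C} then a else a - 1)"
  shows "orbit (block_start n + c) = times_alpha (orbit n) + (0, 0, int c)"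
    and "letter_at (block_start n + c) = block (letter_at n) c"
  using assms orbit_block[of c n] letter_at_block[of c n]
  by (cases "letter_at n"; cases "times_alpha (orbit n)"; auto simp: block_len_def)+

text \<open>A second digit \<open>a - 1\<close> in a row leads to a value that is not in the orbit but lies \<open>1\<close> below a point of
  the orbit; the two zeros that must follow repair this by \<open>orbit_minus_one_after_C\<close>.\<close>

lemma orbit_run:
  assumes "letter_at n \<in> {B, D}"
  shows "\<exists>q>0. letter_at (q - 1) = C \<and> times_alpha (orbit n) + (0, 0, int (a - 1)) = orbit q - (1, 0, 0)"
proof -
  let ?q = "block_start n + (a - 1)"
  have "orbit ?q = times_alpha (orbit n) + (0, 0, int (a - 1)) + (1, 0, 0)"
    using assms orbit_block[of "a - 1" n] by (auto simp: block_len_def)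
  moreover have "letter_at (?q - 1) = C"
    using assms letter_at_block[of "a - 2" n] a_ge_2
    by (auto simp: block_len_def numeral_2_eq_2)
  ultimately show ?thesis using a_ge_2 by (intro exI[of _ ?q]) auto
qed

lemma digit_step_cases:
  "digit_step c s = 4 \<or> s = 0 \<and> c < a \<or> s = 1 \<and> c < a - 1 \<or> s = 1 \<and> c = a - 1
    \<or> s = 2 \<and> c = 0 \<or> s = 3 \<and> c = 0"
proof -
  consider "s = 0" | "s = 1" | "s = 2" | "s = 3" | "s \<ge> 4" by linarith
  then show ?thesis using a_ge_2 by cases (auto simp: digit_step_def)
qed

text \<open>Values of accepted words lie in the orbit; the invariants for states 2 and 3 cover the places
  inside \<open>(a - 1)(a - 1)00\<close> where this fails.\<close>

lemma digit_state_orbit: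
  "(digit_state ws = 0 \<longrightarrow> (\<exists>n. digit_val ws = orbit n \<and> letter_at n \<in> {A, C})) \<and>
   (digit_state ws = 1 \<longrightarrow> (\<exists>n. digit_val ws = orbit n \<and> letter_at n \<in> {B, D})) \<and>
   (digit_state ws = 2 \<longrightarrow> (\<exists>q>0. letter_at (q - 1) = C \<and> digit_val ws = orbit q - (1, 0, 0))) \<and>
   (digit_state ws = 3 \<longrightarrow> (\<exists>q>0. letter_at (q - 1) = C \<and>
      digit_val ws = times_alpha (orbit q - (1, 0, 0))))"
proof (induction ws)
  case Nil
  have "\<exists>n. digit_val [] = orbit n \<and> letter_at n \<in> {A, C}"
    by (rule exI[of _ 0]) (simp add: letter_at_0 zero_prod_def)
  then show ?case by (simp del: digit_val.simps)
next
  case (Cons c ws)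
  let ?s = "digit_state ws"
  consider "?s = 0" "c < a" | "?s = 1" "c < a - 1" | "?s = 1" "c = a - 1"
    | "?s = 2" "c = 0" | "?s = 3" "c = 0" | "digit_state (c # ws) = 4"
    using digit_step_cases[of c ?s] unfolding digit_state_Cons by metis
  then show ?case
  proof cases
    case 1
    then obtain n where n: "digit_val ws = orbit n" "letter_at n \<in> {A, C}" using Cons.IH by blast
    have "digit_val (c # ws) = orbit (block_start n + c)"
      "letter_at (block_start n + c) \<in> (if c < a - 1 then {A, C} else {B, D})"
      using orbit_digit_below[of c n] n 1 by (auto split: if_splits)
    moreover have "digit_state (c # ws) = (if c < a - 1 then 0 else 1)"
      using 1 by (auto simp: digit_state_Cons digit_step_def)
    ultimately show ?thesis by (cases "c < a - 1") auto
  next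
    case 2
    then obtain n where n: "digit_val ws = orbit n" "letter_at n \<in> {B, D}" using Cons.IH by blast
    have "digit_val (c # ws) = orbit (block_start n + c)" "letter_at (block_start n + c) \<in> {A, C}"
      using orbit_digit_below[of c n] n 2 by (auto split: if_splits)
    moreover have "digit_state (c # ws) = 0"
      using 2 by (auto simp: digit_state_Cons digit_step_def)
    ultimately show ?thesis by auto
  next
    case 3
    then obtain n where n: "digit_val ws = orbit n" "letter_at n \<in> {B, D}" using Cons.IH by blast
    have "digit_state (c # ws) = 2"
      using 3 by (auto simp: digit_state_Cons digit_step_def)
    with orbit_run[OF n(2)] show ?thesis using n(1) 3 by auto
  next
    case 4
    moreover have "digit_state (c # ws) = 3"
      using 4 by (auto simp: digit_state_Cons digit_step_def)
    ultimately show ?thesis using Cons.IH by (auto simp flip: zero_prod_def)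
  next
    case 5
    then obtain q where q: "q > 0" "letter_at (q - 1) = C"
      "digit_val ws = times_alpha (orbit q - (1, 0, 0))" using Cons.IH by blast
    then have "digit_val (c # ws) = (times_alpha ^^ 2) (orbit q - (1, 0, 0))"
      using 5 by (simp add: numeral_2_eq_2 flip: zero_prod_def)
    moreover have "digit_state (c # ws) = 0"
      using 5 by (auto simp: digit_state_Cons digit_step_def)
    ultimately show ?thesis using orbit_minus_one_after_C[OF q(1,2)] by auto
  qed auto
qed

text \<open>The position in the block is the last digit, with one exception: the last element of the block of
  \<open>D\<close>, whose word ends in \<open>(a - 1)00\<close> after a digit \<open>a - 1\<close>.\<close>

lemma orbit_digits:
  "\<exists>ws. digit_val ws = orbit n \<and> digit_state ws = (if letter_at n \<in> {A, C} then 0 else 1)"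
proof (induction n rule: less_induct)
  case (less n)
  show ?case
  proof (cases "n = 0")
    case True
    then show ?thesis using letter_at_0 by (intro exI[of _ "[]"]) (auto simp: zero_prod_def)
  next
    case False
    obtain m c where mc: "n = block_start m + c" "c < block_len (letter_at m)"
      by (rule block_decomposition)
    have "m < n" using mc False block_start_gt[of m] by (cases "m = 0") auto
    then obtain ws where ws: "digit_val ws = orbit m"
      "digit_state ws = (if letter_at m \<in> {A, C} then 0 else 1)" using less.IH by blast
    show ?thesis
    proof (cases "letter_at m = D \<and> c = a - 1")
      case False
      then have c: "c < (if letter_at m \<in> {A, C} then a else a - 1)"
        using mc(2) by (cases "letter_at m") (auto simp: block_len_def)
      have "digit_val (c # ws) = orbit n"
        using orbit_digit_below(1)[OF c] ws(1) mc(1) by simp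
      moreover have "digit_state (c # ws) = (if letter_at n \<in> {A, C} then 0 else 1)"
        using orbit_digit_below(2)[OF c] ws(2) mc(1) c
        by (cases "letter_at m") (auto simp: digit_state_Cons digit_step_def)
      ultimately show ?thesis by blast
    next
      case True
      obtain m1 c1 where m1: "m = block_start m1 + c1" "c1 < block_len (letter_at m1)"
        by (rule block_decomposition)
      then have "block (letter_at m1) c1 = D" using True by (simp add: letter_at_block)
      then have C: "letter_at m1 = C" "c1 = a - 1"
        using m1(2) by (cases "letter_at m1"; auto simp: block_len_def split: if_splits)+
      obtain m2 c2 where m2: "m1 = block_start m2 + c2" "c2 < block_len (letter_at m2)"
        by (rule block_decomposition)
      then have "block (letter_at m2) c2 = C" using C by (simp add: letter_at_block)
      then have BD: "letter_at m2 \<in> {B, D}" "c2 = a - 2"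
        using m2(2) by (cases "letter_at m2"; auto simp: block_len_def split: if_splits)+
      have "m2 < n"
        using \<open>m < n\<close> m1(1) m2(1) block_start_ge[of m1] block_start_ge[of m2] by linarith
      with less.IH[of m2] BD(1) obtain ws2
        where ws2: "digit_val ws2 = orbit m2" "digit_state ws2 = 1" by auto
      have n: "orbit n = times_alpha (times_alpha (times_alpha (orbit m2) + (0, 0, int (a - 2)))
          + (0, 0, int (a - 1))) + (0, 0, int (a - 1)) + (1, 0, 0)"
      proof -
        have "orbit m1 = times_alpha (orbit m2) + (0, 0, int (a - 2))"
          using orbit_digit_below(1)[of c2 m2] BD m2(1) a_ge_2 by auto
        moreover have "orbit m = times_alpha (orbit m1) + (0, 0, int (a - 1))"
          using orbit_digit_below(1)[of c1 m1] C m1(1) a_ge_2 by auto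
        moreover have "orbit n = times_alpha (orbit m) + (0, 0, int (a - 1)) + (1, 0, 0)"
          using orbit_block[of c m] True mc(1) by (auto simp: block_len_def)
        ultimately show ?thesis by simp
      qed
      have "digit_val (0 # 0 # (a - 1) # ws2) = orbit n"
        unfolding n using ws2(1) a_ge_2
        by (cases "times_alpha (orbit m2)") (simp add: of_nat_diff algebra_simps)
      moreover have "digit_state (0 # 0 # (a - 1) # ws2) = 0"
        using ws2(2) a_ge_2 by (simp add: digit_state_Cons digit_step_def)
      moreover have "letter_at n = A"
        using letter_at_block[of c m] True mc a_ge_2 by auto
      ultimately show ?thesis by (metis insertI1)
    qed
  qed
qed

end

context cubic_roots begin

section \<open>The closed set and its dense orbit\<close>

definition admissible :: "(nat \<Rightarrow> nat) \<Rightarrow> bool" where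
  "admissible w \<longleftrightarrow> (\<forall>N\<ge>2. greedy_G_expansion a N w)"

definition prefix_val :: "(nat \<Rightarrow> nat) \<Rightarrow> nat \<Rightarrow> int \<times> int \<times> int" where
  "prefix_val w k = digit_val (map w [2..<2 + k])"

definition tail_const :: real where
  "tail_const = real a / (1 - cmod \<alpha>)"

lemma admissible_digit: "admissible w \<Longrightarrow> w (i + 2) \<le> a - 1"
  unfolding admissible_def greedy_G_expansion_def by (metis atLeastAtMost_iff le_add2 order_refl)

lemma prefix_val_Suc:
  "prefix_val w (Suc k) = prefix_val w k + (times_alpha ^^ k) (0, 0, int (w (k + 2)))"
proof -
  have "map w [2..<2 + Suc k] = map w [2..<2 + k] @ [w (k + 2)]" by (simp add: add.commute)
  moreover have "length (map w [2..<2 + k]) = k" by (simp only: length_map length_upt)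
  ultimately show ?thesis
    unfolding prefix_val_def by (simp only: digit_val_append digit_val.simps times_alpha_0 add_0)
qed

lemma cval_prefix_val: "cval (prefix_val w k) = (\<Sum>i<k. of_nat (w (i + 2)) * \<alpha> ^ (i + 2))"
proof (induction k)
  case (Suc k)
  then show ?case
    by (simp add: prefix_val_Suc cval_add cval_funpow power_add power2_eq_square)
qed (simp add: prefix_val_def zero_prod_def)

lemma bval_prefix_val: "bval (prefix_val w k) = (\<Sum>i<k. of_nat (w (i + 2)) * \<beta> ^ (i + 2))"
proof (induction k)
  case (Suc k)
  then show ?case
    by (simp add: prefix_val_Suc bval_add bval_funpow power_add power2_eq_square)
qed (simp add: prefix_val_def zero_prod_def)

lemma prefix_val_orbit:
  assumes "admissible w"
  shows "\<exists>n. prefix_val w k = orbit n"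
proof (cases k)
  case 0
  then have "prefix_val w k = orbit 0" by (simp add: prefix_val_def zero_prod_def)
  then show ?thesis by blast
next
  case (Suc k')
  then have "greedy_G_expansion a (Suc k) w" using assms by (auto simp: admissible_def)
  from greedy_imp_digit_state[OF this]
  have "digit_state (map w [2..<2 + k]) \<le> 1" by (simp del: upt_Suc)
  then have "digit_state (map w [2..<2 + k]) = 0 \<or> digit_state (map w [2..<2 + k]) = 1"
    by linarith
  then show ?thesis
    using digit_state_orbit[of "map w [2..<2 + k]"] unfolding prefix_val_def by blast
qed

text \<open>Truncation before the exponent \<open>k + 2\<close>; the constant does not depend on the word.\<close>

lemma tail_bound:
  assumes "admissible w" "(\<lambda>i. of_nat (w (i + 2)) * \<alpha> ^ (i + 2)) sums z"
  shows "cmod (z - cval (prefix_val w k)) \<le> tail_const * cmod \<alpha> ^ k"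
proof -
  let ?f = "\<lambda>i. of_nat (w (i + 2)) * \<alpha> ^ (i + 2)"
  have sums: "(\<lambda>i. ?f (i + k)) sums (z - cval (prefix_val w k))"
    using sums_split_initial_segment[OF assms(2), of k] by (simp add: cval_prefix_val)
  have bound: "norm (?f (i + k)) \<le> (real a * cmod \<alpha> ^ k) * cmod \<alpha> ^ i" for i
  proof -
    have "real (w (i + k + 2)) * cmod \<alpha> ^ (i + k + 2) \<le> real a * cmod \<alpha> ^ (i + k)"
    proof (intro mult_mono)
      show "real (w (i + k + 2)) \<le> real a" using admissible_digit[OF assms(1), of "i + k"] by simp
      show "cmod \<alpha> ^ (i + k + 2) \<le> cmod \<alpha> ^ (i + k)"
        using norm_alpha_lt_1 by (intro power_decreasing) auto
    qed auto
    then show ?thesis by (simp add: norm_mult norm_power power_add mult_ac)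
  qed
  have geo: "(\<lambda>i. (real a * cmod \<alpha> ^ k) * cmod \<alpha> ^ i) sums (real a * cmod \<alpha> ^ k * (1 / (1 - cmod \<alpha>)))"
    using norm_alpha_lt_1 by (intro sums_mult geometric_sums) auto
  have "norm (\<Sum>i. ?f (i + k)) \<le> (\<Sum>i. (real a * cmod \<alpha> ^ k) * cmod \<alpha> ^ i)"
    by (rule norm_suminf_le[OF bound]) (use geo in \<open>auto simp: sums_iff\<close>)
  then show ?thesis using sums geo by (simp add: sums_iff tail_const_def)
qed

lemma alpha_power_small:
  assumes "e > 0" shows "\<exists>k0. \<forall>k\<ge>k0. K * cmod \<alpha> ^ k < e"
proof -
  have "(\<lambda>k. K * cmod \<alpha> ^ k) \<longlonglongrightarrow> K * 0"
    using norm_alpha_lt_1 by (intro tendsto_mult tendsto_const LIMSEQ_power_zero) auto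
  then have "\<forall>\<^sub>F k in sequentially. K * cmod \<alpha> ^ k < e"
    using assms by (intro order_tendstoD) auto
  then show ?thesis by (simp add: eventually_sequentially)
qed

lemma G_set_iff:
  "z \<in> G_set a \<alpha> \<longleftrightarrow> (\<exists>w. admissible w \<and> (\<lambda>i. of_nat (w (i + 2)) * \<alpha> ^ (i + 2)) sums z)"
  by (simp add: G_set_def admissible_def)

lemma orbit_dense_in_G_set:
  assumes "z \<in> G_set a \<alpha>" "e > 0"
  shows "\<exists>n. cmod (z - cval (orbit n)) < e"
proof -
  obtain w where w: "admissible w" "(\<lambda>i. of_nat (w (i + 2)) * \<alpha> ^ (i + 2)) sums z"
    using assms(1) by (auto simp: G_set_iff)
  obtain k where "tail_const * cmod \<alpha> ^ k < e" using alpha_power_small[OF assms(2)] by blast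
  then have "cmod (z - cval (prefix_val w k)) < e" using tail_bound[OF w, of k] by linarith
  then show ?thesis using prefix_val_orbit[OF w(1), of k] by metis
qed

lemma greedy_mono: "greedy_G_expansion a N w \<Longrightarrow> N' \<le> N \<Longrightarrow> greedy_G_expansion a N' w"
  by (auto simp: greedy_G_expansion_def)

lemma greedy_cong:
  assumes "\<And>i. 2 \<le> i \<Longrightarrow> i \<le> N \<Longrightarrow> w i = w' i"
  shows "greedy_G_expansion a N w \<longleftrightarrow> greedy_G_expansion a N w'"
proof -
  have "map w [2..<Suc N] = map w' [2..<Suc N]"
    by (rule map_cong[OF refl]) (use assms in auto)
  then show ?thesis
    using greedy_imp_digit_state digit_state_imp_greedy by metis
qed

lemma digit_state_zeros: "digit_state ws \<le> 1 \<Longrightarrow> g > 0 \<Longrightarrow> digit_state (replicate g 0 @ ws) = 0"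
proof (induction g)
  case (Suc g)
  then show ?case using a_ge_2 by (cases "g = 0") (auto simp: digit_state_Cons digit_step_def)
qed simp

lemma digit_state_append: "digit_state ws = 0 \<Longrightarrow> digit_state (us @ ws) = digit_state us"
  by (simp add: digit_state_def)

lemma orbit_in_G_set: "cval (orbit n) \<in> G_set a \<alpha>"
proof -
  obtain ws where ws: "digit_val ws = orbit n" "digit_state ws \<le> 1"
    using orbit_digits[of n] by (metis le_numeral_extra(4) zero_le)
  define w where "w i = (if i - 2 < length ws then ws ! (i - 2) else 0)" for i
  have pre: "map w [2..<2 + (length ws + g)] = ws @ replicate g 0" for g
  proof -
    have "[2..<2 + m] = map (\<lambda>i. i + 2) [0..<m]" for m
      by (simp only: map_add_upt add.commute)
    then have "map w [2..<2 + (length ws + g)] = map (\<lambda>i. w (i + 2)) [0..<length ws + g]"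
      by (simp only: map_map comp_def)
    also have "\<dots> = ws @ replicate g 0"
      by (rule nth_equalityI) (auto simp: w_def nth_append simp del: upt_Suc)
    finally show ?thesis .
  qed
  have zeros: "digit_state (replicate g 0) = 0" for g
    using digit_state_zeros[of "[]" g] by (cases "g = 0") auto
  have "greedy_G_expansion a N w" for N
  proof -
    have "digit_state (map w [2..<Suc (length ws + N + 1)]) \<le> 1"
      using pre[of N] digit_state_append[OF zeros, of ws N] ws(2) by (simp del: upt_Suc)
    then show ?thesis using digit_state_imp_greedy greedy_mono by (metis le_add1 le_add2 le_trans)
  qed
  then have "admissible w" by (simp add: admissible_def)
  moreover have "(\<lambda>i. of_nat (w (i + 2)) * \<alpha> ^ (i + 2)) sums cval (orbit n)"
  proof -
    have "cval (orbit n) = (\<Sum>i<length ws. of_nat (w (i + 2)) * \<alpha> ^ (i + 2))"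
    proof -
      have "prefix_val w (length ws) = orbit n"
        using pre[of 0] ws(1) by (simp only: prefix_val_def add_0_right replicate_0 append_Nil2)
      then show ?thesis using cval_prefix_val[of w "length ws"] by simp
    qed
    then show ?thesis using sums_finite[of "{..<length ws}" "\<lambda>i. of_nat (w (i + 2)) * \<alpha> ^ (i + 2)"]
      by (auto simp: w_def)
  qed
  ultimately show ?thesis by (auto simp: G_set_iff)
qed

text \<open>A limit point is a limit of points whose words agree on longer and longer initial parts: since there
  are finitely many digits, the next digit can be chosen such that the point stays in the closure of
  the part of the set with this initial word.\<close>

lemma closed_G_set: "closed (G_set a \<alpha>)"
proof -
  define A where "A u n = {z. \<exists>w. admissible w \<and> (\<forall>i. 2 \<le> i \<and> i < n + 2 \<longrightarrow> w i = u i)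
    \<and> (\<lambda>i. of_nat (w (i + 2)) * \<alpha> ^ (i + 2)) sums z}" for u :: "nat \<Rightarrow> nat" and n :: nat
  have "z \<in> G_set a \<alpha>" if z: "z \<in> closure (G_set a \<alpha>)" for z
  proof -
    have "A (\<lambda>_. 0) 0 = G_set a \<alpha>" by (auto simp: A_def G_set_iff)
    then have base: "z \<in> closure (A (\<lambda>_. 0) 0)" using z by simp
    have "\<exists>u'. z \<in> closure (A u' (Suc n)) \<and> (\<forall>i. i < n + 2 \<longrightarrow> u' i = u i)"
      if "z \<in> closure (A u n)" for u n
    proof -
      have "A u n \<subseteq> (\<Union>c\<in>{..a - 1}. A (u(n + 2 := c)) (Suc n))"
      proof
        fix y assume "y \<in> A u n"
        then obtain w where w: "admissible w" "\<forall>i. 2 \<le> i \<and> i < n + 2 \<longrightarrow> w i = u i"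
          "(\<lambda>i. of_nat (w (i + 2)) * \<alpha> ^ (i + 2)) sums y" by (auto simp: A_def)
        then have "y \<in> A (u(n + 2 := w (n + 2))) (Suc n)"
          unfolding A_def by (auto simp: less_Suc_eq)
        then show "y \<in> (\<Union>c\<in>{..a - 1}. A (u(n + 2 := c)) (Suc n))"
          using admissible_digit[OF w(1), of n] by blast
      qed
      then have "closure (A u n) \<subseteq> (\<Union>c\<in>{..a - 1}. closure (A (u(n + 2 := c)) (Suc n)))"
      proof (rule closure_minimal[OF subset_trans])
        show "(\<Union>c\<in>{..a - 1}. A (u(n + 2 := c)) (Suc n))
          \<subseteq> (\<Union>c\<in>{..a - 1}. closure (A (u(n + 2 := c)) (Suc n)))"
          using closure_subset by fast
      qed auto
      with that obtain c where "z \<in> closure (A (u(n + 2 := c)) (Suc n))" by blast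
      then show ?thesis by (intro exI[of _ "u(n + 2 := c)"]) auto
    qed
    then obtain f where f: "\<And>n. z \<in> closure (A (f n) n)"
      "\<And>n i. i < n + 2 \<Longrightarrow> f (Suc n) i = f n i"
      using dependent_nat_choice[of "\<lambda>n u. z \<in> closure (A u n)"
        "\<lambda>n u u'. \<forall>i. i < n + 2 \<longrightarrow> u' i = u i"] base by metis
    have agree: "f m i = f n i" if "n \<le> m" "i < n + 2" for n m i
      using that by (induction m rule: dec_induct) (auto simp: f(2))
    define w where "w i = f i i" for i
    have w: "w i = f n i" if "2 \<le> i" "i < n + 2" for i n
      unfolding w_def using agree[of i n i] agree[of n i i] that by (metis less_add_same_cancel1 nat_le_linear zero_less_numeral)
    have near: "\<exists>w' z'. admissible w' \<and> (\<forall>i. 2 \<le> i \<and> i < n + 2 \<longrightarrow> w' i = w i)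
      \<and> (\<lambda>i. of_nat (w' (i + 2)) * \<alpha> ^ (i + 2)) sums z' \<and> cmod (z' - z) < e" if e: "e > 0" for n e
    proof -
      obtain z' where "z' \<in> A (f n) n" "dist z' z < e"
        using f(1)[of n] e unfolding closure_approachable by blast
      then show ?thesis using w[of _ n] by (auto simp: A_def dist_norm)
    qed
    have "admissible w"
      unfolding admissible_def
    proof (intro allI impI)
      fix N :: nat assume "N \<ge> 2"
      from near[of 1 N] obtain w' where w': "admissible w'" "\<forall>i. 2 \<le> i \<and> i < N + 2 \<longrightarrow> w' i = w i"
        by auto
      then have "greedy_G_expansion a N w'" using \<open>N \<ge> 2\<close> by (simp add: admissible_def)
      then show "greedy_G_expansion a N w" using greedy_cong[of N w' w] w'(2) by simp
    qed
    moreover have "(\<lambda>n. cval (prefix_val w n)) \<longlonglongrightarrow> z"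
    proof (rule LIMSEQ_I)
      fix e :: real assume "e > 0"
      then obtain k0 where k0: "\<forall>k\<ge>k0. tail_const * cmod \<alpha> ^ k < e / 2"
        using alpha_power_small[of "e / 2"] by auto
      have "cmod (cval (prefix_val w n) - z) < e" if "n \<ge> k0" for n
      proof -
        obtain w' z' where w': "admissible w'" "\<forall>i. 2 \<le> i \<and> i < n + 2 \<longrightarrow> w' i = w i"
          "(\<lambda>i. of_nat (w' (i + 2)) * \<alpha> ^ (i + 2)) sums z'" "cmod (z' - z) < e / 2"
          using near[of "e / 2" n] \<open>e > 0\<close> by auto
        have "prefix_val w' n = prefix_val w n"
          unfolding prefix_val_def using w'(2) by (intro arg_cong[of _ _ digit_val] map_cong) auto
        then have "cmod (z' - cval (prefix_val w n)) < e / 2"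
          using tail_bound[OF w'(1,3), of n] k0 that by fastforce
        then have "cmod ((z' - z) - (z' - cval (prefix_val w n))) < e / 2 + e / 2"
          using w'(4) norm_triangle_ineq4[of "z' - z" "z' - cval (prefix_val w n)"] by linarith
        then show ?thesis by simp
      qed
      then show "\<exists>no. \<forall>n\<ge>no. norm (cval (prefix_val w n) - z) < e" by blast
    qed
    ultimately show ?thesis unfolding G_set_iff sums_def cval_prefix_val by blast
  qed
  then show ?thesis by (metis closure_subset_eq subsetI)
qed

section \<open>Translates contain no point of the orbit\<close>

lemma times_alpha_surj: "\<exists>s. (times_alpha ^^ k) s = d"
proof (induction k arbitrary: d)
  case (Suc k)
  obtain p q r where d: "d = (p, q, r)" by (metis prod_cases3)
  have "times_alpha (q + p, r - int a * p, p) = d" by (simp add: d)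
  moreover obtain s where "(times_alpha ^^ k) s = (q + p, r - int a * p, p)" using Suc.IH by blast
  ultimately have "(times_alpha ^^ Suc k) s = d" by simp
  then show ?case by blast
qed simp

text \<open>Words can be concatenated once a zero separates them.\<close>

lemma orbit_concat:
  "\<exists>g0. \<forall>g\<ge>g0. \<exists>k. orbit n + (times_alpha ^^ g) (orbit m) = orbit k"
proof -
  obtain us where us: "digit_val us = orbit n" "digit_state us \<le> 1"
    using orbit_digits[of n] by (metis le_numeral_extra(4) zero_le)
  obtain ws where ws: "digit_val ws = orbit m" "digit_state ws \<le> 1"
    using orbit_digits[of m] by (metis le_numeral_extra(4) zero_le)
  have zeros: "digit_val (replicate i 0) = 0" for i
    by (induction i) (auto simp: zero_prod_def)
  have "\<exists>k. orbit n + (times_alpha ^^ g) (orbit m) = orbit k" if "g \<ge> length us + 1" for g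
  proof -
    define i where "i = g - length us"
    have i: "i > 0" "g = length us + i" using that by (auto simp: i_def)
    let ?vs = "us @ (replicate i 0 @ ws)"
    have "digit_val ?vs = orbit n + (times_alpha ^^ g) (orbit m)"
      unfolding digit_val_append zeros i(2) funpow_add us(1) ws(1) by simp
    moreover have "digit_state ?vs = 0 \<or> digit_state ?vs = 1"
      using digit_state_append[OF digit_state_zeros[OF ws(2) i(1)], of us] us(2) by auto
    ultimately have "\<exists>k. digit_val ?vs = orbit k" using digit_state_orbit[of ?vs] by blast
    then show ?thesis unfolding \<open>digit_val ?vs = orbit n + (times_alpha ^^ g) (orbit m)\<close> .
  qed
  then show ?thesis by blast
qed

text \<open>Let \<open>z\<close> have digits \<open>w\<close>, and suppose that \<open>z + u = x\<^sub>n\<close>.  The difference between the \<open>k\<close>-th partial sum,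
  translated by \<open>u\<close>, and \<open>x\<^sub>n\<close> is \<open>\<alpha>\<^sup>k s\<^sub>k\<close> where \<open>s\<^sub>k\<close> is bounded in both embeddings.  Some value \<open>s\<close> occurs
  infinitely often.  If \<open>s\<close> is positive, then \<open>\<alpha>\<^sup>k s \<in> X\<close> has so many low zeros that adding \<open>x\<^sub>n\<close> stays in
  \<open>X\<close>, and comparing third coordinates gives \<open>u = 0\<close>.  The partial sums are nonnegative in the real
  embedding, so \<open>s\<close> cannot be negative; if its real embedding is \<open>0\<close>, the digits vanish from some point on
  and \<open>s = 0\<close>.\<close>

lemma orbit_not_in_translate:
  assumes "z \<in> G_set a \<alpha>" "cval (orbit n) = z + cval (p, q, 0)"
  shows "p = 0 \<and> q = 0"
proof -
  obtain w where w: "admissible w" "(\<lambda>i. of_nat (w (i + 2)) * \<alpha> ^ (i + 2)) sums z"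
    using assms(1) by (auto simp: G_set_iff)
  define v where "v = (p, q, 0) - orbit n"
  have "\<exists>s. \<forall>k. (times_alpha ^^ k) (s k) = prefix_val w k + v"
    by (intro choice allI times_alpha_surj)
  then obtain s where s: "\<And>k. (times_alpha ^^ k) (s k) = prefix_val w k + v" by blast
  have done_if: "p = 0 \<and> q = 0" if "prefix_val w k + (p, q, 0) = orbit m" for k m
  proof -
    obtain t where t: "prefix_val w k = orbit t" using prefix_val_orbit[OF w(1)] by blast
    with that have eq: "orbit t + (p, q, 0) = orbit m" by simp
    have "t = m" using arg_cong[OF eq, of "\<lambda>v. snd (snd v)"] by (simp add: orbit_third)
    with eq show ?thesis by (cases "orbit m") auto
  qed
  have c_bound: "cmod (cval (s k)) \<le> tail_const" for k
  proof -
    have "\<alpha> ^ k * cval (s k) = cval (prefix_val w k) - z"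
      using assms(2) unfolding cval_funpow[symmetric] s v_def cval_add cval_diff by simp
    then have "cmod \<alpha> ^ k * cmod (cval (s k)) \<le> tail_const * cmod \<alpha> ^ k"
      using tail_bound[OF w, of k] by (metis norm_minus_commute norm_mult norm_power)
    then show ?thesis using alpha_nz by (simp add: mult.commute)
  qed
  have b_eq: "\<beta> ^ k * bval (s k) = (\<Sum>i<k. of_nat (w (i + 2)) * \<beta> ^ (i + 2)) + bval v" for k
    unfolding bval_funpow[symmetric] s bval_add bval_prefix_val ..
  define K where "K = real a * \<beta>\<^sup>2 / (\<beta> - 1) + \<bar>bval v\<bar>"
  have b_bound: "\<bar>bval (s k)\<bar> \<le> K" for k
  proof -
    have pow: "\<beta> ^ k \<ge> 1" using beta_gt_1 by simp
    have "(\<Sum>i<k. of_nat (w (i + 2)) * \<beta> ^ (i + 2)) \<le> (\<Sum>i<k. (real a * \<beta>\<^sup>2) * \<beta> ^ i)"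
    proof (rule sum_mono)
      fix i
      have "real (w (i + 2)) \<le> real a" using admissible_digit[OF w(1), of i] by simp
      then have "real (w (i + 2)) * \<beta> ^ (i + 2) \<le> real a * \<beta> ^ (i + 2)"
        using beta_gt_1 by (intro mult_right_mono) auto
      then show "of_nat (w (i + 2)) * \<beta> ^ (i + 2) \<le> (real a * \<beta>\<^sup>2) * \<beta> ^ i"
        by (simp add: power_add power2_eq_square mult_ac)
    qed
    also have "\<dots> = (real a * \<beta>\<^sup>2) * ((\<beta> ^ k - 1) / (\<beta> - 1))"
      using beta_gt_1 by (simp add: geometric_sum flip: sum_distrib_left)
    also have "\<dots> \<le> (real a * \<beta>\<^sup>2) * (\<beta> ^ k / (\<beta> - 1))"
      using beta_gt_1 by (intro mult_left_mono divide_right_mono) auto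
    finally have 1: "(\<Sum>i<k. of_nat (w (i + 2)) * \<beta> ^ (i + 2)) \<le> (real a * \<beta>\<^sup>2 / (\<beta> - 1)) * \<beta> ^ k"
      by simp
    have 2: "(\<Sum>i<k. of_nat (w (i + 2)) * \<beta> ^ (i + 2)) \<ge> 0"
      using beta_gt_1 by (intro sum_nonneg) auto
    have 3: "\<bar>bval v\<bar> \<le> \<bar>bval v\<bar> * \<beta> ^ k" using mult_left_mono[OF pow, of "\<bar>bval v\<bar>"] by simp
    have "\<bar>\<beta> ^ k * bval (s k)\<bar> \<le> K * \<beta> ^ k"
      using 1 2 3 unfolding b_eq K_def distrib_right by linarith
    then have "\<beta> ^ k * \<bar>bval (s k)\<bar> \<le> \<beta> ^ k * K" using pow by (simp add: abs_mult mult.commute)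
    then show ?thesis using pow by (simp add: mult_le_cancel_left)
  qed
  have "finite (range s)"
    by (rule finite_subset[OF _ finite_bounded_triples[of tail_const K]]) (use c_bound b_bound in auto)
  then obtain k1 where inf: "infinite {k. s k = s k1}"
    using pigeonhole_infinite[of UNIV s] by auto
  let ?t = "s k1"
  have often: "\<exists>k\<ge>k0. s k = ?t" for k0
    using inf unfolding infinite_nat_iff_unbounded_le by blast
  consider "bval ?t > 0" | "bval ?t < 0" | "bval ?t = 0" by linarith
  then show ?thesis
  proof cases
    case 1
    obtain J where "(times_alpha ^^ J) ?t \<in> range orbit"
      using reaches_orbit_if_positive[OF 1] unfolding reaches_orbit_def by (elim exE)
    then obtain m where J: "(times_alpha ^^ J) ?t = orbit m" by (elim rangeE)
    obtain g0 where g0: "\<forall>g\<ge>g0. \<exists>k. orbit n + (times_alpha ^^ g) (orbit m) = orbit k"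
      using orbit_concat by blast
    obtain k where k: "k \<ge> g0 + J" "s k = ?t" using often by blast
    have "(times_alpha ^^ (k - J)) (orbit m) = prefix_val w k + v"
    proof -
      have "(times_alpha ^^ (k - J)) ((times_alpha ^^ J) ?t) = (times_alpha ^^ (k - J + J)) ?t"
        by (simp only: funpow_add comp_apply)
      also have "k - J + J = k" using k(1) by simp
      finally show ?thesis using s[of k] unfolding J k(2) by (rule trans)
    qed
    moreover have "k - J \<ge> g0" using k by simp
    ultimately obtain j where "orbit n + (prefix_val w k + v) = orbit j"
      using g0[rule_format, of "k - J"] by auto
    then show ?thesis using done_if[of k j] by (simp add: v_def)
  next
    case 2
    obtain k0 where "(\<bar>bval v\<bar> + 1) / (- bval ?t) < \<beta> ^ k0" using real_arch_pow[OF beta_gt_1] by blast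
    then have k0: "\<beta> ^ k0 * (- bval ?t) > \<bar>bval v\<bar>" using 2 by (simp add: divide_less_eq field_simps)
    obtain k where k: "k \<ge> k0" "s k = ?t" using often by blast
    have "\<beta> ^ k0 * (- bval ?t) \<le> \<beta> ^ k * (- bval ?t)"
      using k(1) 2 beta_gt_1 by (intro mult_right_mono power_increasing) auto
    moreover have "\<beta> ^ k * bval ?t \<ge> bval v"
      using b_eq[of k] k(2) beta_gt_1 sum_nonneg[of "{..<k}" "\<lambda>i. of_nat (w (i + 2)) * \<beta> ^ (i + 2)"]
      by auto
    ultimately show ?thesis using k0 by auto
  next
    case 3
    obtain k where k_t: "s k = ?t" using often[of 0] by blast
    obtain k' where "k' \<ge> Suc k" "s k' = ?t" using often[of "Suc k"] by blast
    with k_t have k: "s k = ?t" "k < k'" "s k' = ?t" by simp_all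
    let ?f = "\<lambda>i. of_nat (w (i + 2)) * \<beta> ^ (i + 2)"
    have "\<beta> ^ k * bval (s k) = 0" "\<beta> ^ k' * bval (s k') = 0" unfolding k(1,3) 3 by simp_all
    then have "(\<Sum>i<k'. ?f i) = (\<Sum>i<k. ?f i)" unfolding b_eq by linarith
    moreover have "(\<Sum>i<k'. ?f i) = (\<Sum>i<k. ?f i) + (\<Sum>i\<in>{k..<k'}. ?f i)"
      using sum.atLeastLessThan_concat[OF le0 less_imp_le[OF k(2)], of ?f]
      unfolding lessThan_atLeast0 by (rule sym)
    ultimately have "(\<Sum>i\<in>{k..<k'}. ?f i) = 0" by linarith
    have z: "w (i + 2) = 0" if "i \<in> {k..<k'}" for i
    proof -
      have nonneg: "0 \<le> ?f i" for i using beta_gt_1 by (intro mult_nonneg_nonneg) simp_all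
      have "?f i = 0"
        by (rule sum_nonneg_0[OF _ _ \<open>(\<Sum>i\<in>{k..<k'}. ?f i) = 0\<close> that]) (simp, rule nonneg)
      moreover have "\<beta> ^ (i + 2) \<noteq> 0" using beta_gt_1 by (intro power_not_zero) simp
      ultimately show ?thesis unfolding mult_eq_0_iff by (simp only: of_nat_eq_0_iff simp_thms)
    qed
    have zero: "(times_alpha ^^ j) 0 = 0" for j by (induction j) simp_all
    have const: "prefix_val w j = prefix_val w k" if "k \<le> j" "j \<le> k'" for j
      using that
    proof (induction j rule: dec_induct)
      case (step j)
      have "w (j + 2) = 0" using z[of j] step by simp
      then have digit: "(0, 0, int (w (j + 2))) = (0 :: int \<times> int \<times> int)"
        by (simp add: zero_prod_def)
      have "prefix_val w (Suc j) = prefix_val w j"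
        unfolding prefix_val_Suc digit zero by (rule add_0_right)
      then show ?case using step by simp
    qed simp
    have "prefix_val w k' = prefix_val w k" by (rule const[OF less_imp_le[OF k(2)] order_refl])
    then have "(times_alpha ^^ k) (s k) = (times_alpha ^^ k') (s k')" unfolding s by (simp only:)
    from arg_cong[OF this, of cval] have same: "\<alpha> ^ k * cval ?t = \<alpha> ^ k' * cval ?t"
      unfolding k(1,3) cval_funpow .
    have "cmod \<alpha> ^ k' < cmod \<alpha> ^ k"
      using k(2) norm_alpha_lt_1 alpha_nz by (intro power_strict_decreasing) simp_all
    then have "cmod (\<alpha> ^ k) \<noteq> cmod (\<alpha> ^ k')" unfolding norm_power by linarith
    then have "\<alpha> ^ k \<noteq> \<alpha> ^ k'" by (rule contrapos_nn) (rule arg_cong)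
    with same have "cval ?t = 0" unfolding mult_cancel_right by blast
    then have "?t = 0" using 3 by (rule vals_zero)
    then have "prefix_val w k + v = 0" using s[of k] unfolding k(1) by (simp only: zero)
    then have "prefix_val w k + (p, q, 0) = orbit n" by (simp add: v_def algebra_simps)
    then show ?thesis by (rule done_if)
  qed
qed

section \<open>Small translations away from the neighbouring tiles\<close>

text \<open>Coordinates \<open>(x, y)\<close> of the elements \<open>x + y\<alpha>\<close> of \<open>B\<close>.\<close>

definition neighbours :: "(int \<times> int) set" where
  "neighbours = {(1, 0), (-1, 0), (0, 1), (0, -1), (-1, 1), (1, -1)}"

lemma orbit_add_alpha_pow_neighbours:
  assumes "j \<ge> 2"
  obtains n' x y where "n' > n" "orbit n + alpha_pow j = orbit n' + (x, y, 0)"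
    "(x, y) = (0, 0) \<or> (x, y) \<in> neighbours"
proof -
  obtain n' x y where *: "n' > n" "orbit n + alpha_pow j = orbit n' + (x, y, 0)"
    "(x, y, letter_at n, letter_at n') \<in> set neighbour_states"
    by (rule orbit_add_alpha_pow'[OF assms])
  moreover have "(x, y) = (0, 0) \<or> (x, y) \<in> neighbours"
    using *(3) by (auto simp: neighbour_states_def neighbours_def)
  ultimately show ?thesis using that by blast
qed

lemma cval_alpha_pow: "cval (alpha_pow j) = \<alpha> ^ j"
  unfolding alpha_pow_def cval_funpow by simp

context
  fixes z :: complex and r :: real
  assumes r: "r > 0"
    and away: "\<And>x y g. (x, y) \<in> neighbours \<Longrightarrow> g \<in> G_set a \<alpha> \<Longrightarrow> g + cval (x, y, 0) \<notin> ball z r"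
begin

lemma orbit_step_up:
  assumes "j \<ge> 2" "cval (orbit n) + \<alpha> ^ j \<in> ball z r"
  shows "\<exists>n'. orbit n + alpha_pow j = orbit n'"
proof -
  obtain n' x y where *: "orbit n + alpha_pow j = orbit n' + (x, y, 0)"
    "(x, y) = (0, 0) \<or> (x, y) \<in> neighbours"
    by (rule orbit_add_alpha_pow_neighbours[OF assms(1)])
  have "cval (orbit n) + \<alpha> ^ j = cval (orbit n') + cval (x, y, 0)"
    using arg_cong[OF *(1), of cval] by (simp only: cval_add cval_alpha_pow)
  then have "(x, y) \<notin> neighbours" using away[of x y] orbit_in_G_set[of n'] assms(2) by metis
  then have "x = 0" "y = 0" using *(2) by auto
  then have "orbit n + alpha_pow j = orbit n'" using *(1) by (cases "orbit n'") simp
  then show ?thesis by blast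
qed

lemma orbit_step_down:
  assumes "j \<ge> 2" "cval (orbit n) - \<alpha> ^ j \<in> ball z r" "int n \<ge> snd (snd (alpha_pow j))"
  shows "\<exists>n'. orbit n - alpha_pow j = orbit n'"
proof -
  define m where "m = n - nat (snd (snd (alpha_pow j)))"
  have m: "int n = int m + snd (snd (alpha_pow j))"
    using assms(3) alpha_pow_third_mono[OF assms(1)] by (simp add: m_def)
  obtain n' x y where *: "orbit m + alpha_pow j = orbit n' + (x, y, 0)"
    "(x, y) = (0, 0) \<or> (x, y) \<in> neighbours"
    by (rule orbit_add_alpha_pow_neighbours[OF assms(1)])
  have "n' = n" using arg_cong[OF *(1), of "\<lambda>v. snd (snd v)"] m by (simp add: orbit_third)
  then have eq: "orbit n - alpha_pow j = orbit m + (- x, - y, 0)"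
    using *(1) by (cases "orbit n"; cases "orbit m"; cases "alpha_pow j") auto
  have "cval (orbit n) - \<alpha> ^ j = cval (orbit m) + cval (- x, - y, 0)"
    using arg_cong[OF eq, of cval] by (simp only: cval_add cval_diff cval_alpha_pow)
  then have "(- x, - y) \<notin> neighbours"
    using away[of "- x" "- y"] orbit_in_G_set[of m] assms(2) by metis
  then have "(x, y) \<notin> neighbours" by (auto simp: neighbours_def)
  then have "x = 0" "y = 0" using *(2) by auto
  then have "orbit n - alpha_pow j = orbit m" using eq by (cases "orbit m") simp
  then show ?thesis by blast
qed

text \<open>Subtracting a power of \<open>\<alpha>\<close> needs a large index; adding tiny powers of \<open>\<alpha>\<close> raises the index without
  leaving the neighbourhood.\<close>

lemma orbit_near_large:
  assumes "p \<in> G_set a \<alpha>" "p \<in> ball z r" "e > 0"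
  shows "\<exists>n\<ge>N. cmod (p - cval (orbit n)) < e"
  using assms(3)
proof (induction N arbitrary: e)
  case 0
  then show ?case using orbit_dense_in_G_set[OF assms(1)] by blast
next
  case (Suc N)
  define d where "d = min e (r - dist z p)"
  have d: "d > 0" "d \<le> e" "d \<le> r - dist z p" using Suc.prems assms(2) by (auto simp: d_def)
  obtain n where n: "n \<ge> N" "cmod (p - cval (orbit n)) < d / 2" using Suc.IH[of "d / 2"] d by auto
  obtain k0 where k0: "\<forall>k\<ge>k0. 1 * cmod \<alpha> ^ k < d / 2"
    using alpha_power_small[of "d / 2" 1] d by auto
  have small: "cmod (\<alpha> ^ (k0 + 2)) < d / 2"
    using k0[rule_format, of "k0 + 2"] unfolding norm_power by simp
  have "cmod (p - (cval (orbit n) + \<alpha> ^ (k0 + 2))) < d"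
    using norm_triangle_ineq4[of "p - cval (orbit n)" "\<alpha> ^ (k0 + 2)"] n(2) small
    by (simp add: diff_diff_eq)
  moreover from this have "cval (orbit n) + \<alpha> ^ (k0 + 2) \<in> ball z r"
    using d(3) dist_triangle[of z "cval (orbit n) + \<alpha> ^ (k0 + 2)" p] by (simp add: dist_norm)
  then obtain n' where n': "orbit n + alpha_pow (k0 + 2) = orbit n'"
    using orbit_step_up[of "k0 + 2" n] by auto
  moreover have "n' > n"
    using arg_cong[OF n', of "\<lambda>v. snd (snd v)"] alpha_pow_third_mono[of "k0 + 2"]
    by (simp add: orbit_third)
  moreover have "cval (orbit n') = cval (orbit n) + \<alpha> ^ (k0 + 2)"
    using arg_cong[OF n', of cval] by (simp only: cval_add cval_alpha_pow)
  ultimately show ?case using n(1) d(2) by (intro exI[of _ n']) auto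
qed

lemma G_set_step:
  assumes "p \<in> G_set a \<alpha>" "p \<in> ball z r" "j \<ge> 2" "u \<in> {\<alpha> ^ j, - (\<alpha> ^ j)}" "p + u \<in> ball z r"
  shows "p + u \<in> G_set a \<alpha>"
proof -
  have "\<exists>y\<in>G_set a \<alpha>. dist y (p + u) < e" if "e > 0" for e
  proof -
    define d where "d = min e (r - dist z (p + u))"
    have d: "d > 0" "d \<le> e" "d \<le> r - dist z (p + u)" using that assms(5) by (auto simp: d_def)
    obtain n where n: "n \<ge> nat (snd (snd (alpha_pow j)))" "cmod (p - cval (orbit n)) < d"
      using orbit_near_large[OF assms(1,2) d(1)] by blast
    have close: "dist (cval (orbit n) + u) (p + u) < d"
      using n(2) by (simp add: dist_norm norm_minus_commute)
    then have ball: "cval (orbit n) + u \<in> ball z r"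
      using d(3) dist_triangle[of z "cval (orbit n) + u" "p + u"] by (simp add: dist_commute)
    have "\<exists>n'. cval (orbit n) + u = cval (orbit n')"
    proof (cases "u = \<alpha> ^ j")
      case True
      then obtain n' where "orbit n + alpha_pow j = orbit n'"
        using orbit_step_up[OF assms(3)] ball by blast
      then show ?thesis using True by (metis cval_add cval_alpha_pow)
    next
      case False
      then have u: "cval (orbit n) + u = cval (orbit n) - (\<alpha> ^ j)" using assms(4) by simp
      then obtain n' where "orbit n - alpha_pow j = orbit n'"
        using orbit_step_down[OF assms(3)] ball n(1) by (metis nat_le_iff)
      then show ?thesis using u by (metis cval_diff cval_alpha_pow)
    qed
    then show ?thesis using close d(2) orbit_in_G_set by (metis order_less_le_trans)
  qed
  then have "p + u \<in> closure (G_set a \<alpha>)" by (simp add: closure_approachable)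
  then show ?thesis using closed_G_set by simp
qed

text \<open>Otherwise \<open>w\<close> would be almost orthogonal to two consecutive powers of \<open>\<alpha>\<close>, which span the plane.\<close>

lemma power_step_closer:
  assumes "w \<noteq> 0" "e > 0"
  shows "\<exists>j\<ge>2. \<exists>u\<in>{\<alpha> ^ j, - (\<alpha> ^ j)}. cmod u < e \<and> cmod (w - u) < cmod w"
proof (rule ccontr)
  assume neg: "\<not> ?thesis"
  define C where "C = 1 + 1 / \<bar>Im \<alpha>\<bar>"
  have "C > 0" by (auto simp: C_def add_pos_nonneg)
  obtain k1 where k1: "\<forall>k\<ge>k1. 1 * cmod \<alpha> ^ k < e" using alpha_power_small[OF assms(2), of 1] by auto
  obtain k2 where k2: "\<forall>k\<ge>k2. C * cmod \<alpha> ^ k < cmod w"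
    using alpha_power_small[of "cmod w" C] assms(1) by auto
  define j where "j = max 2 (max k1 k2)"
  have flat: "\<bar>Re (cnj w * \<alpha> ^ i)\<bar> \<le> (cmod \<alpha> ^ i)\<^sup>2 / 2" if "i \<ge> j" for i
  proof -
    have i: "i \<ge> 2" using \<open>i \<ge> j\<close> by (simp add: j_def)
    have small: "cmod u < e" if "u \<in> {\<alpha> ^ i, - (\<alpha> ^ i)}" for u
      using k1 \<open>i \<ge> j\<close> that by (auto simp: j_def norm_power)
    have far: "cmod w \<le> cmod (w - u)" if "u \<in> {\<alpha> ^ i, - (\<alpha> ^ i)}" for u
    proof -
      have "\<not> cmod (w - u) < cmod w" using neg small[OF that] that i by blast
      then show ?thesis by simp
    qed
    have expand: "(cmod (w - u))\<^sup>2 = (cmod w)\<^sup>2 - 2 * Re (cnj w * u) + (cmod u)\<^sup>2" for u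
      unfolding cmod_power2 by (simp add: power2_eq_square algebra_simps)
    have "2 * Re (cnj w * u) \<le> (cmod u)\<^sup>2" if "u \<in> {\<alpha> ^ i, - (\<alpha> ^ i)}" for u
      using power_mono[OF far[OF that], of 2] expand[of u] by simp
    from this[of "\<alpha> ^ i"] this[of "- (\<alpha> ^ i)"]
    have "2 * Re (cnj w * \<alpha> ^ i) \<le> (cmod \<alpha> ^ i)\<^sup>2" "- (2 * Re (cnj w * \<alpha> ^ i)) \<le> (cmod \<alpha> ^ i)\<^sup>2"
      by (simp_all add: norm_power)
    then show ?thesis by linarith
  qed
  let ?v = "cnj w * \<alpha> ^ j"
  have mono: "cmod \<alpha> ^ Suc j \<le> cmod \<alpha> ^ j" using norm_alpha_lt_1 by (intro power_decreasing) auto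
  have sq: "(cmod \<alpha> ^ Suc j)\<^sup>2 \<le> (cmod \<alpha> ^ j)\<^sup>2" by (rule power_mono[OF mono]) simp
  have "Re (cnj w * \<alpha> ^ Suc j) = Re \<alpha> * Re ?v - Im \<alpha> * Im ?v"
    by (simp add: algebra_simps)
  then have "\<bar>Im \<alpha> * Im ?v\<bar> \<le> \<bar>Re (cnj w * \<alpha> ^ Suc j)\<bar> + \<bar>Re \<alpha> * Re ?v\<bar>" by linarith
  also have "\<bar>Re \<alpha> * Re ?v\<bar> \<le> \<bar>Re ?v\<bar>"
  proof -
    have "\<bar>Re \<alpha>\<bar> \<le> 1" using abs_Re_le_cmod[of \<alpha>] norm_alpha_lt_1 by simp
    then have "\<bar>Re \<alpha>\<bar> * \<bar>Re ?v\<bar> \<le> 1 * \<bar>Re ?v\<bar>" by (intro mult_right_mono) auto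
    then show ?thesis by (simp only: abs_mult mult_1)
  qed
  finally have "\<bar>Im \<alpha>\<bar> * \<bar>Im ?v\<bar> \<le> (cmod \<alpha> ^ j)\<^sup>2"
    using flat[of j] flat[of "Suc j"] sq by (simp only: abs_mult) linarith
  then have "\<bar>Im ?v\<bar> \<le> (cmod \<alpha> ^ j)\<^sup>2 / \<bar>Im \<alpha>\<bar>" using Im_alpha by (simp add: pos_le_divide_eq mult.commute)
  moreover have "\<bar>Re ?v\<bar> \<le> (cmod \<alpha> ^ j)\<^sup>2"
    using flat[OF order_refl] zero_le_power2[of "cmod \<alpha> ^ j"] by linarith
  ultimately have "cmod ?v \<le> (cmod \<alpha> ^ j)\<^sup>2 + (cmod \<alpha> ^ j)\<^sup>2 / \<bar>Im \<alpha>\<bar>"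
    using cmod_le[of ?v] by linarith
  also have "\<dots> = C * (cmod \<alpha> ^ j)\<^sup>2" by (simp add: C_def distrib_right)
  finally have "cmod ?v \<le> C * (cmod \<alpha> ^ j)\<^sup>2" .
  then have "cmod w * cmod \<alpha> ^ j \<le> (C * cmod \<alpha> ^ j) * cmod \<alpha> ^ j"
    by (simp add: norm_mult norm_power power2_eq_square mult.assoc)
  then have "cmod w \<le> C * cmod \<alpha> ^ j" using alpha_nz by simp
  then show False using k2 by (auto simp: j_def not_le[symmetric])
qed

text \<open>From the point of the set nearest to a missing point, one of the small translations leads closer.\<close>

lemma ball_subset_G_set:
  assumes "z \<in> G_set a \<alpha>"
  shows "ball z (r / 2) \<subseteq> G_set a \<alpha>"
proof (rule ccontr)
  assume "\<not> ?thesis"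
  then obtain q where "q \<in> ball z (r / 2)" and qG: "q \<notin> G_set a \<alpha>" by blast
  then have q: "dist z q < r / 2" by simp
  obtain p where p: "p \<in> G_set a \<alpha>" "\<And>y. y \<in> G_set a \<alpha> \<Longrightarrow> dist q p \<le> dist q y"
    using distance_attains_inf[OF closed_G_set, of q] assms by auto
  have "dist q p < r / 2" using p(2)[OF assms] q by (simp add: dist_commute)
  then have zp: "dist z p < r" using q dist_triangle[of z p q] by simp
  have "q - p \<noteq> 0" using p(1) qG by auto
  have "r - dist z p > 0" using zp by simp
  from power_step_closer[OF \<open>q - p \<noteq> 0\<close> this] obtain j u where ju: "j \<ge> 2" "u \<in> {\<alpha> ^ j, - (\<alpha> ^ j)}" "cmod u < r - dist z p"
    "cmod (q - p - u) < cmod (q - p)"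
    by blast
  have "dist z (p + u) < r"
    using ju(3) dist_triangle[of z "p + u" p] by (simp add: dist_norm)
  then have "p + u \<in> G_set a \<alpha>" using G_set_step[OF p(1) _ ju(1,2)] zp by simp
  then have "cmod (q - p) \<le> cmod (q - p - u)" using p(2) by (simp add: dist_norm diff_diff_eq)
  then show False using ju(4) by simp
qed

end

section \<open>The boundary\<close>

lemma frontier_G_set:
  "frontier (G_set a \<alpha>) =
    (\<Union>(x, y)\<in>neighbours. G_set a \<alpha> \<inter> (\<lambda>z. z + cval (x, y, 0)) ` G_set a \<alpha>)"
proof (intro equalityI subsetI)
  fix z assume z: "z \<in> frontier (G_set a \<alpha>)"
  then have zG: "z \<in> G_set a \<alpha>" using closed_G_set by (simp add: frontier_def)
  show "z \<in> (\<Union>(x, y)\<in>neighbours. G_set a \<alpha> \<inter> (\<lambda>z. z + cval (x, y, 0)) ` G_set a \<alpha>)"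
  proof (rule ccontr)
    assume no: "z \<notin> (\<Union>(x, y)\<in>neighbours. G_set a \<alpha> \<inter> (\<lambda>z. z + cval (x, y, 0)) ` G_set a \<alpha>)"
    define W where "W = (\<Union>(x, y)\<in>neighbours. (\<lambda>z. z + cval (x, y, 0)) ` G_set a \<alpha>)"
    have "closed ((\<lambda>z. z + c) ` G_set a \<alpha>)" for c
      using closed_translation[OF closed_G_set, of c] by (simp add: add.commute)
    moreover have "finite neighbours" by (simp add: neighbours_def)
    ultimately have "closed W"
      unfolding W_def by (intro closed_UN) (auto simp del: cval.simps)
    moreover have "z \<notin> W" using no zG by (auto simp: W_def)
    ultimately obtain r where r: "r > 0" "ball z r \<subseteq> - W"
      by (metis ComplI open_Compl open_contains_ball)
    have "ball z (r / 2) \<subseteq> G_set a \<alpha>"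
    proof (rule ball_subset_G_set[OF r(1) _ zG])
      fix x y g assume "(x, y) \<in> neighbours" "g \<in> G_set a \<alpha>"
      then have "g + cval (x, y, 0) \<in> W" unfolding W_def by blast
      then show "g + cval (x, y, 0) \<notin> ball z r" using r(2) by blast
    qed
    then have "z \<in> interior (G_set a \<alpha>)" using r(1) by (meson half_gt_zero mem_interior)
    with z show False by (simp add: frontier_def)
  qed
next
  fix z assume "z \<in> (\<Union>(x, y)\<in>neighbours. G_set a \<alpha> \<inter> (\<lambda>z. z + cval (x, y, 0)) ` G_set a \<alpha>)"
  then obtain x y g where xy: "(x, y) \<in> neighbours" and zG: "z \<in> G_set a \<alpha>"
    and g: "g \<in> G_set a \<alpha>" "z = g + cval (x, y, 0)" by blast
  have "z \<notin> interior (G_set a \<alpha>)"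
  proof
    assume "z \<in> interior (G_set a \<alpha>)"
    then obtain e where e: "e > 0" "ball z e \<subseteq> G_set a \<alpha>" by (auto simp: mem_interior)
    obtain n where "cmod (g - cval (orbit n)) < e" using orbit_dense_in_G_set[OF g(1) e(1)] by blast
    then have "cval (orbit n) + cval (x, y, 0) \<in> G_set a \<alpha>"
      using e(2) g(2) by (auto simp: dist_norm)
    moreover have "cval (orbit n) = (cval (orbit n) + cval (x, y, 0)) + cval (- x, - y, 0)"
      by simp
    ultimately have "- x = 0 \<and> - y = 0" by (rule orbit_not_in_translate)
    then show False using xy by (auto simp: neighbours_def)
  qed
  then show "z \<in> frontier (G_set a \<alpha>)" using zG closed_G_set by (simp add: frontier_def)
qed

end

lemma cubic_roots_of_factorization:
  fixes a :: nat and \<beta> :: real and \<alpha> \<gamma> :: complex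
  assumes "a \<ge> 2"
    and poly: "[:-1, 1, - of_nat a, 1:] = [:- of_real \<beta>, 1:] * [:- \<alpha>, 1:] * [:- \<gamma>, 1:]"
    and "\<beta> > 1" "\<alpha> \<notin> \<real>" "\<gamma> = cnj \<alpha>" "norm \<alpha> < 1"
  shows "cubic_roots a \<beta> \<alpha>"
proof -
  have ev: "- 1 + x - of_nat a * x\<^sup>2 + x ^ 3 = (x - of_real \<beta>) * (x - \<alpha>) * (x - \<gamma>)" for x :: complex
    using arg_cong[OF poly, of "\<lambda>p. poly p x"]
    by (simp add: algebra_simps power2_eq_square power3_eq_cube)
  have co: "of_nat a = of_real \<beta> + \<alpha> + \<gamma>" "of_real \<beta> * \<alpha> * \<gamma> = 1"
    using poly by (auto simp: algebra_simps)
  have "complex_of_real (\<beta> ^ 3) = complex_of_real (real a * \<beta>\<^sup>2 - \<beta> + 1)"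
    using ev[of "of_real \<beta>"] by (simp add: algebra_simps)
  then have b: "\<beta> ^ 3 = real a * \<beta>\<^sup>2 - \<beta> + 1" by (simp only: of_real_eq_iff)
  show ?thesis
  proof
    show "\<alpha> ^ 3 = of_nat a * \<alpha>\<^sup>2 - \<alpha> + 1" using ev[of \<alpha>] by (simp add: algebra_simps)
    show "2 * Re \<alpha> = real a - \<beta>" using arg_cong[OF co(1), of Re] assms(5) by simp
    have "of_real \<beta> * (\<alpha> * cnj \<alpha>) = 1" using co(2) assms(5) by (simp add: mult.assoc)
    then have "complex_of_real (\<beta> * (cmod \<alpha>)\<^sup>2) = 1"
      unfolding complex_norm_square[symmetric] by simp
    then show "(cmod \<alpha>)\<^sup>2 * \<beta> = 1" by (metis mult.commute of_real_eq_1_iff)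
    show "Im \<alpha> \<noteq> 0" using assms(4) by (simp add: complex_is_Real_iff)
  qed (use assms b in auto)
qed

theorem theorem4p4:
  fixes a :: nat and \<beta> :: real and \<alpha> \<gamma> :: complex
  assumes "a \<ge> 2"
    and "[:-1, 1, - of_nat a, 1:] = [:- of_real \<beta>, 1:] * [:- \<alpha>, 1:] * [:- \<gamma>, 1:]"
    and "\<beta> > 1"
    and "\<alpha> \<notin> \<real>" and "\<gamma> \<notin> \<real>" and "\<gamma> = cnj \<alpha>"
    and "norm \<alpha> < 1"
  shows "frontier (G_set a \<alpha>) =
    (\<Union>u\<in>{1, - 1, \<alpha>, - \<alpha>, \<alpha> - 1, - (\<alpha> - 1)}.
       G_set a \<alpha> \<inter> (\<lambda>z. z + u) ` G_set a \<alpha>)"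
proof -
  interpret cubic_roots a \<beta> \<alpha>
    using assms by (intro cubic_roots_of_factorization) auto
  have *: "(\<lambda>(x, y). cval (x, y, 0)) ` neighbours = {1, - 1, \<alpha>, - \<alpha>, \<alpha> - 1, - (\<alpha> - 1)}"
    by (auto simp: neighbours_def)
  show ?thesis unfolding frontier_G_set *[symmetric]
    by (simp add: case_prod_unfold del: cval.simps)
qed

end
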